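(* Let $n\ge 1$, $r>1$ and $a>1$. There are constants $c=c(a,r)$ and $d=d(n)$ such that the following holds. Let $f\in\mathcal{F}_r$, let $x\in\mathbb{R}^n$ and $t>0$ be such that $$B(x,t)\subset B_c(x,at)\subset B_c(0,1),$$ and let $\omega\subset B(x,t)$ be a measurable subset with $|\omega|>0$. Then $$\sup_{B(x,t)} f\le c\log\left(\frac{d\,|B(x,t)|}{|\omega|}\right)+\sup_{\omega} f .$$
   Context: $\mathbb{R}^n$ is identified with the real points of $\mathbb{C}^n$. $B(x,\rho)$ denotes the Euclidean ball in $\mathbb{R}^n$ with center $x$ and radius $\rho$, and $B_c(x,\rho)$ denotes the Euclidean ball in $\mathbb{C}^n$ with center $x$ and radius $\rho$. $|\cdot|$ denotes Lebesgue measure on $\mathbb{R}^n$. A function is plurisubharmonic on a domain $\Omega\subset\mathbb{C}^n$ if it is upper semicontinuous and its restriction to each component of the intersection of $\Omega$ with a complex line is subharmonic. For $r>1$, the class $\mathcal{F}_r$ consists of the plurisubharmonic functions $f:\mathbb{C}^n\to\mathbb{R}$ such that $\sup_{B_c(0,r)} f=0$ and $\sup_{B_c(0,1)} f\ge -1$. *)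

theory Defs
  imports "HOL-Analysis.Analysis"
begin

text \<open>The dimension n varies inside the statement (the constant c must not depend on n),
so R^n and C^n are represented by explicit carriers: functions on the index set {..<n}
(extensional, i.e. elements of PiE).\<close>

definition RV :: "nat \<Rightarrow> (nat \<Rightarrow> real) set" where
  "RV n = PiE {..<n} (\<lambda>_. UNIV)"

definition CV :: "nat \<Rightarrow> (nat \<Rightarrow> complex) set" where
  "CV n = PiE {..<n} (\<lambda>_. UNIV)"

definition emb :: "nat \<Rightarrow> (nat \<Rightarrow> real) \<Rightarrow> (nat \<Rightarrow> complex)" where
  "emb n x = restrict (\<lambda>i. complex_of_real (x i)) {..<n}"

definition zeroC :: "nat \<Rightarrow> (nat \<Rightarrow> complex)" where
  "zeroC n = restrict (\<lambda>_. 0) {..<n}"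

definition distR :: "nat \<Rightarrow> (nat \<Rightarrow> real) \<Rightarrow> (nat \<Rightarrow> real) \<Rightarrow> real" where
  "distR n x y = sqrt (\<Sum>i<n. (x i - y i)\<^sup>2)"

definition distC :: "nat \<Rightarrow> (nat \<Rightarrow> complex) \<Rightarrow> (nat \<Rightarrow> complex) \<Rightarrow> real" where
  "distC n z w = sqrt (\<Sum>i<n. (cmod (z i - w i))\<^sup>2)"

definition ballR :: "nat \<Rightarrow> (nat \<Rightarrow> real) \<Rightarrow> real \<Rightarrow> (nat \<Rightarrow> real) set" where
  "ballR n x \<rho> = {y \<in> RV n. distR n x y < \<rho>}"

definition ballC :: "nat \<Rightarrow> (nat \<Rightarrow> complex) \<Rightarrow> real \<Rightarrow> (nat \<Rightarrow> complex) set" where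
  "ballC n z \<rho> = {w \<in> CV n. distC n z w < \<rho>}"

definition lebN :: "nat \<Rightarrow> (nat \<Rightarrow> real) measure" where
  "lebN n = completion (PiM {..<n} (\<lambda>_. lborel))"

text \<open>Subharmonic real-valued functions on C: upper semicontinuous with the local
sub-mean-value property (the circle mean is required to be finite, which for a
finite-valued u is equivalent to the inequality u(z) \<le> mean in the extended sense).\<close>
definition usc_C :: "(complex \<Rightarrow> real) \<Rightarrow> bool" where
  "usc_C u \<longleftrightarrow> (\<forall>z. \<forall>\<epsilon>>0. \<exists>\<delta>>0. \<forall>w. cmod (w - z) < \<delta> \<longrightarrow> u w < u z + \<epsilon>)"

definition subharmonic :: "(complex \<Rightarrow> real) \<Rightarrow> bool" where
  "subharmonic u \<longleftrightarrow> usc_C u \<and>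
     (\<forall>z. \<exists>\<epsilon>>0. \<forall>\<rho>. 0 < \<rho> \<and> \<rho> < \<epsilon> \<longrightarrow>
        interval_lebesgue_integrable lborel (ereal 0) (ereal (2*pi)) (\<lambda>\<theta>. u (z + of_real \<rho> * cis \<theta>)) \<and>
        u z \<le> (1 / (2*pi)) * (LBINT \<theta>=0..2*pi. u (z + of_real \<rho> * cis \<theta>)))"

definition usc_CV :: "nat \<Rightarrow> ((nat \<Rightarrow> complex) \<Rightarrow> real) \<Rightarrow> bool" where
  "usc_CV n f \<longleftrightarrow> (\<forall>z\<in>CV n. \<forall>\<epsilon>>0. \<exists>\<delta>>0. \<forall>w\<in>CV n. distC n z w < \<delta> \<longrightarrow> f w < f z + \<epsilon>)"

definition psh :: "nat \<Rightarrow> ((nat \<Rightarrow> complex) \<Rightarrow> real) \<Rightarrow> bool" where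
  "psh n f \<longleftrightarrow> usc_CV n f \<and>
     (\<forall>a\<in>CV n. \<forall>b\<in>CV n. subharmonic (\<lambda>s. f (restrict (\<lambda>i. a i + s * b i) {..<n})))"

definition F_class :: "nat \<Rightarrow> real \<Rightarrow> ((nat \<Rightarrow> complex) \<Rightarrow> real) set" where
  "F_class n r = {f. psh n f \<and> Sup (f ` ballC n (zeroC n) r) = 0
                      \<and> Sup (f ` ballC n (zeroC n) 1) \<ge> -1}"

end

(* The constant c depends on r alone. On a complex line, a subharmonic u that is at most 0 on a disc
   of radius R and at most -P on a compact real set E of length m is compared with a multiple of the
   Green potential of normalized Lebesgue measure on E: this potential vanishes on the circle, is
   harmonic off E and is at most 1 + log (8R/m) everywhere. The resulting inequality is applied to f
   on three kinds of lines: to pass from a real ball to a complex ball, from there to a ball about the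
   origin and to a point where f is at least -2, which bounds sup f on B(x,t) from below by a multiple
   of -(1 + log (1/t)); and on a real line through a point w that meets omega in a long set. If t is
   small, w is a nearly extremal point of B(x,t), and the two factors log (1/t) cancel. If t is
   bounded below, w is a point near the origin where f is not too negative. *)
theory Submission
  imports Defs "HOL-Complex_Analysis.Cauchy_Integral_Formula"
begin

section \<open>Circle means\<close>

text \<open>The factor in front of the logarithm may not see the dimension. Every analytic step
  therefore takes place on one complex line, with constants that depend on \<open>r\<close> only,
  and the dimension enters solely through the length of a radial slice of omega, which is bounded
  below by a multiple of |omega| divided by the volume of a ball whose radius is at most H times
  that of B(x,t). The loss is n ln H. For small t the factor H is 4, and d(n) takes up 4^n. For t
  bounded below, H depends on \<open>r\<close> and cannot go into d(n); there n ln H is at most a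
  multiple of ln (4^n), and the multiple goes into c.

  The coefficient of sup f over omega must be exactly 1. With L this supremum, the inequality on the
  line has the form |L| ln R <= |f(w)| (1 + ln (8R/m)). The R inside the logarithm contributes
  |f(w)| ln R, which becomes |f(w)| itself after division by ln R. If t is bounded below, |f(w)| is
  bounded and f <= 0 on B(x,t) suffices.\<close>

lemma set_integrable_Icc_if_Ioo:
  fixes f :: "real \<Rightarrow> real"
  assumes "set_integrable lborel {a<..<b} f"
  shows "set_integrable lborel {a..b} f"
proof -
  have single: "set_integrable lborel {c} f" for c
  proof -
    have "integrable lborel (\<lambda>x. indicator {c} x *\<^sub>R f c)" by simp
    then show ?thesis unfolding set_integrable_def
      by (rule back_subst[where P="integrable lborel"]) (auto simp: fun_eq_iff indicator_def)
  qed
  have "set_integrable lborel ({a<..<b} \<union> ({a} \<union> {b})) f"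
    using assms single by (intro set_integrable_Un) auto
  then show ?thesis by (rule set_integrable_subset) auto
qed

text \<open>Circle means are taken over the closed interval from here on: continuous integrands are
  integrable there by compactness.\<close>

lemma subharmonic_sub_mean:
  assumes "subharmonic u"
  obtains \<epsilon> where "\<epsilon> > 0"
    "\<And>\<rho>. 0 < \<rho> \<Longrightarrow> \<rho> < \<epsilon> \<Longrightarrow> set_integrable lborel {0..2*pi} (\<lambda>\<theta>. u (z + of_real \<rho> * cis \<theta>))"
    "\<And>\<rho>. 0 < \<rho> \<Longrightarrow> \<rho> < \<epsilon> \<Longrightarrow> 2 * pi * u z \<le> (LINT \<theta>:{0..2*pi}|lborel. u (z + of_real \<rho> * cis \<theta>))"
proof -
  from assms obtain \<epsilon> where e: "\<epsilon> > 0"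
    "\<And>\<rho>. 0 < \<rho> \<and> \<rho> < \<epsilon> \<Longrightarrow>
        interval_lebesgue_integrable lborel (ereal 0) (ereal (2*pi)) (\<lambda>\<theta>. u (z + of_real \<rho> * cis \<theta>)) \<and>
        u z \<le> (1 / (2*pi)) * (LBINT \<theta>=0..2*pi. u (z + of_real \<rho> * cis \<theta>))"
    unfolding subharmonic_def by metis
  show ?thesis
  proof
    show "\<epsilon> > 0" by fact
    fix \<rho> :: real assume r: "0 < \<rho>" "\<rho> < \<epsilon>"
    note e2 = e(2)[OF conjI[OF r]]
    show "set_integrable lborel {0..2*pi} (\<lambda>\<theta>. u (z + of_real \<rho> * cis \<theta>))"
      using e2 set_integrable_Icc_if_Ioo by (simp add: interval_lebesgue_integrable_def)
    have "u z \<le> (1 / (2*pi)) * (LINT \<theta>:{0..2*pi}|lborel. u (z + of_real \<rho> * cis \<theta>))"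
      using e2 unfolding zero_ereal_def by (simp only: interval_integral_Icc pi_ge_zero mult_nonneg_nonneg zero_le_numeral)
    then show "2 * pi * u z \<le> (LINT \<theta>:{0..2*pi}|lborel. u (z + of_real \<rho> * cis \<theta>))"
      by (simp add: field_simps)
  qed
qed

text \<open>The affine function has no zero in the closed disc. Divided by its value at the centre
  it becomes \<open>g\<close>, with \<open>g c = 1\<close> and positive real part, so
  \<open>Ln\<close> of it is holomorphic and Cauchy's formula gives mean 0.\<close>

lemma ln_cmod_affine_circle_mean:
  fixes \<alpha> \<beta> c :: complex
  assumes "0 < \<rho>" and nz: "cmod \<beta> * \<rho> < cmod (\<alpha> + \<beta> * c)"
  shows "(LINT \<theta>:{0..2*pi}|lborel. ln (cmod (\<alpha> + \<beta> * (c + of_real \<rho> * cis \<theta>))))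
    = 2 * pi * ln (cmod (\<alpha> + \<beta> * c))"
proof -
  define k where "k = \<alpha> + \<beta> * c"
  have k0: "k \<noteq> 0" using nz assms(1) unfolding k_def by (smt (verit) mult_nonneg_nonneg norm_ge_zero norm_zero)
  define g where "g z = 1 + \<beta> * (z - c) / k" for z
  have gk: "\<alpha> + \<beta> * z = k * g z" for z
    using k0 unfolding g_def k_def by (simp add: field_simps)
  have small: "cmod (\<beta> * (z - c) / k) < 1" if "z \<in> cball c \<rho>" for z
  proof -
    have "cmod (\<beta> * (z - c)) \<le> cmod \<beta> * \<rho>"
      using that by (simp add: norm_mult mult_left_mono dist_norm norm_minus_commute)
    then show ?thesis using nz k0 unfolding k_def[symmetric] by (simp add: norm_divide)
  qed
  have Re: "Re (g z) > 0" if "z \<in> cball c \<rho>" for z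
    using small[OF that] abs_Re_le_cmod[of "\<beta> * (z - c) / k"] unfolding g_def by simp
  have hol: "(\<lambda>z. Ln (g z)) holomorphic_on cball c \<rho>"
  proof (intro holomorphic_intros)
    show "g holomorphic_on cball c \<rho>" unfolding g_def using k0 by (intro holomorphic_intros) auto
    show "\<And>z. z \<in> cball c \<rho> \<Longrightarrow> g z \<notin> \<real>\<^sub>\<le>\<^sub>0"
      using Re by (metis complex_nonpos_Reals_iff not_less)
  qed
  have "((\<lambda>u. Ln (g u) / (u - c)) has_contour_integral (2 * of_real pi * \<i> * Ln (g c))) (circlepath c \<rho>)"
    by (rule Cauchy_integral_circlepath_simple[OF hol]) (use assms in auto)
  then have "((\<lambda>t. Ln (g (c + \<rho> * cis t)) / (\<rho> * cis t) * \<rho> * \<i> * cis t) has_integral 0) {0..2*pi}"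
    unfolding circlepath_def by (subst (asm) has_contour_integral_part_circlepath_iff) (auto simp: g_def)
  then have "((\<lambda>t. \<i> * Ln (g (c + \<rho> * cis t))) has_integral 0) {0..2*pi}"
    using assms(1) by (simp add: mult.commute)
  \<comment> \<open>The imaginary part of \<open>\<i> * Ln w\<close> is ln |w|.\<close>
  then have "((\<lambda>t. Im (\<i> * Ln (g (c + \<rho> * cis t)))) has_integral Im 0) {0..2*pi}"
    by (rule has_integral_Im)
  moreover have "Im (\<i> * Ln (g (c + \<rho> * cis t))) = ln (cmod (g (c + \<rho> * cis t)))" for t
  proof -
    have "c + \<rho> * cis t \<in> cball c \<rho>" using assms(1) by (simp add: dist_norm norm_mult)
    then have "g (c + \<rho> * cis t) \<noteq> 0" using Re by fastforce
    then show ?thesis by simp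
  qed
  ultimately have "((\<lambda>t. ln (cmod (g (c + \<rho> * cis t)))) has_integral 0) {0..2*pi}" by simp
  then have "((\<lambda>t. ln (cmod k) + ln (cmod (g (c + \<rho> * cis t)))) has_integral (2*pi - 0) *\<^sub>R ln (cmod k) + 0) {0..2*pi}"
    using has_integral_const_real[of "ln (cmod k)" 0 "2*pi"] by (intro has_integral_add) auto
  moreover have "ln (cmod k) + ln (cmod (g (c + \<rho> * cis t))) = ln (cmod (\<alpha> + \<beta> * (c + \<rho> * cis t)))" for t
  proof -
    have "c + \<rho> * cis t \<in> cball c \<rho>" using assms(1) by (simp add: dist_norm norm_mult)
    then have "g (c + \<rho> * cis t) \<noteq> 0" using Re by fastforce
    then show ?thesis using k0 unfolding gk by (simp add: norm_mult ln_mult)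
  qed
  ultimately have hi: "((\<lambda>t. ln (cmod (\<alpha> + \<beta> * (c + \<rho> * cis t)))) has_integral 2 * pi * ln (cmod k)) {0..2*pi}"
    by simp
  have "set_integrable lborel {0..2*pi} (\<lambda>t. ln (cmod (\<alpha> + \<beta> * (c + \<rho> * cis t))))"
  proof -
    have "\<alpha> + \<beta> * (c + \<rho> * cis t) \<noteq> 0" for t
    proof -
      have "c + \<rho> * cis t \<in> cball c \<rho>" using assms(1) by (simp add: dist_norm norm_mult)
      then have "g (c + \<rho> * cis t) \<noteq> 0" using Re by fastforce
      then show ?thesis using k0 unfolding gk by simp
    qed
    then show ?thesis unfolding set_integrable_def
      by (intro borel_integrable_compact) (auto intro!: continuous_intros)
  qed
  from set_borel_integral_eq_integral(2)[OF this] hi show ?thesis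
    unfolding k_def by (metis integral_unique)
qed

text \<open>The surplus \<rho>^2 over the value at the centre makes a small multiple of |z|^2 a
  strictly subharmonic perturbation in the maximum principle below.\<close>

lemma norm_sq_circle_mean:
  fixes w :: complex
  shows "set_integrable lborel {0..2*pi} (\<lambda>\<theta>. (cmod (w + of_real \<rho> * cis \<theta>))\<^sup>2)"
    and "(LINT \<theta>:{0..2*pi}|lborel. (cmod (w + of_real \<rho> * cis \<theta>))\<^sup>2) = 2 * pi * ((cmod w)\<^sup>2 + \<rho>\<^sup>2)"
proof -
  show i: "set_integrable lborel {0..2*pi} (\<lambda>\<theta>. (cmod (w + of_real \<rho> * cis \<theta>))\<^sup>2)"
    unfolding set_integrable_def by (intro borel_integrable_compact) (auto intro!: continuous_intros)
  define F where "F \<theta> = ((cmod w)\<^sup>2 + \<rho>\<^sup>2) * \<theta> + 2 * \<rho> * (Re w * sin \<theta> - Im w * cos \<theta>)" for \<theta>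
  have eq: "(cmod (w + of_real \<rho> * cis \<theta>))\<^sup>2 = ((cmod w)\<^sup>2 + \<rho>\<^sup>2) + 2 * \<rho> * (Re w * cos \<theta> + Im w * sin \<theta>)" for \<theta>
  proof -
    have "(\<rho> * cos \<theta>)\<^sup>2 + (\<rho> * sin \<theta>)\<^sup>2 = \<rho>\<^sup>2"
      by (metis distrib_left mult.right_neutral power_mult_distrib sin_cos_squared_add2)
    then show ?thesis unfolding cmod_power2 by (simp add: power2_sum algebra_simps)
  qed
  have "((\<lambda>\<theta>. (cmod (w + of_real \<rho> * cis \<theta>))\<^sup>2) has_integral F (2*pi) - F 0) {0..2*pi}"
    by (rule fundamental_theorem_of_calculus)
      (auto simp: F_def eq has_real_derivative_iff_has_vector_derivative[symmetric] intro!: derivative_eq_intros)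
  then show "(LINT \<theta>:{0..2*pi}|lborel. (cmod (w + of_real \<rho> * cis \<theta>))\<^sup>2) = 2 * pi * ((cmod w)\<^sup>2 + \<rho>\<^sup>2)"
    using set_borel_integral_eq_integral(2)[OF i] by (simp add: F_def integral_unique)
qed

text \<open>Without a maximum, each z has a better point \<open>p z\<close>, and the sets where v <
  v(p z) cover K. In a finite subcover, the best of the points \<open>p z\<close> lies in one of
  these sets, so some other \<open>p w\<close> beats it.\<close>

lemma usc_attains_max:
  fixes v :: "'a::metric_space \<Rightarrow> real"
  assumes "compact K" "K \<noteq> {}"
    and usc: "\<And>z e. z \<in> K \<Longrightarrow> e > 0 \<Longrightarrow> \<exists>d>0. \<forall>w\<in>K. dist w z < d \<longrightarrow> v w < v z + e"
  shows "\<exists>z\<in>K. \<forall>w\<in>K. v w \<le> v z"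
proof (rule ccontr)
  assume "\<not> ?thesis"
  then have "\<forall>z\<in>K. \<exists>w\<in>K. v z < v w" by (meson not_le)
  then obtain p where p: "\<And>z. z \<in> K \<Longrightarrow> p z \<in> K" "\<And>z. z \<in> K \<Longrightarrow> v z < v (p z)" by metis
  have "\<exists>d>0. \<forall>w\<in>K. dist w z < d \<longrightarrow> v w < v (p z)" if "z \<in> K" for z
    using usc[OF that, of "v (p z) - v z"] p(2)[OF that] by simp
  then obtain d where d: "\<And>z. z \<in> K \<Longrightarrow> d z > 0"
    "\<And>z w. z \<in> K \<Longrightarrow> w \<in> K \<Longrightarrow> dist w z < d z \<Longrightarrow> v w < v (p z)" by metis
  obtain D where D: "D \<subseteq> K" "finite D" "K \<subseteq> (\<Union>z\<in>D. ball z (d z))"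
    using compactE_image[OF assms(1), of K "\<lambda>z. ball z (d z)"] d(1) by force
  have "D \<noteq> {}" using D assms(2) by auto
  obtain z where z: "z \<in> D" "\<And>w. w \<in> D \<Longrightarrow> v (p w) \<le> v (p z)"
  proof -
    have "Max ((\<lambda>w. v (p w)) ` D) \<in> (\<lambda>w. v (p w)) ` D"
      using D(2) \<open>D \<noteq> {}\<close> by (intro Max_in) auto
    then obtain z where "z \<in> D" "v (p z) = Max ((\<lambda>w. v (p w)) ` D)" by force
    then show thesis using that[of z] D(2) by simp
  qed
  then have "p z \<in> K" using D(1) p by auto
  then obtain w where "w \<in> D" "dist (p z) w < d w" using D(3) by (auto simp: dist_commute)
  then have "v (p z) < v (p w)" using d(2) D(1) \<open>p z \<in> K\<close> by blast
  then show False using z(2)[OF \<open>w \<in> D\<close>] by simp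
qed

section \<open>The Green potential of a compact real set\<close>

text \<open>Since ln y <= y - 1, this function dominates ln (d/s) on (0,d]; it has an elementary
  antiderivative that is continuous at 0.\<close>

lemma sqrt_kernel_integral:
  fixes d :: real
  assumes "d > 0"
  shows "set_integrable lborel {0<..d} (\<lambda>s. 2 * (sqrt (d / s) - 1))"
    and "(LINT s:{0<..d}|lborel. 2 * (sqrt (d / s) - 1)) = 2 * d"
proof -
  define h where "h s = indicator {0<..d} s *\<^sub>R (2 * (sqrt (d / s) - 1))" for s :: real
  have h0: "h s \<ge> 0" for s
    using assms by (auto simp: h_def indicator_def)
  define F where "F s = 4 * sqrt d * sqrt s - 2 * s" for s :: real
  have "(h has_integral F d - F 0) {0..d}"
  proof (rule fundamental_theorem_of_calculus_interior)
    show "continuous_on {0..d} F" unfolding F_def by (intro continuous_intros)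
    show "(F has_vector_derivative h s) (at s)" if "s \<in> {0<..<d}" for s
      using that assms unfolding F_def h_def has_real_derivative_iff_has_vector_derivative[symmetric]
      by (auto intro!: derivative_eq_intros simp: real_sqrt_divide field_simps)
  qed (use assms in auto)
  then have hi: "(h has_integral 2 * d) {0..d}" using assms by (simp add: F_def mult.assoc)
  have ai: "set_integrable lebesgue {0..d} h"
    using hi h0 by (intro nonnegative_absolutely_integrable_1) (auto simp: integrable_on_def)
  have ind: "indicator {0..d} s *\<^sub>R h s = h s" for s by (auto simp: h_def indicator_def)
  have "h \<in> borel_measurable lborel" unfolding h_def by measurable
  then have li: "integrable lborel h"
    using ai unfolding set_integrable_def ind by (subst (asm) integrable_completion) auto
  then show "set_integrable lborel {0<..d} (\<lambda>s. 2 * (sqrt (d / s) - 1))"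
    unfolding set_integrable_def h_def .
  have "set_integrable lborel {0..d} h" unfolding set_integrable_def ind by fact
  from set_borel_integral_eq_integral(2)[OF this] hi
  show "(LINT s:{0<..d}|lborel. 2 * (sqrt (d / s) - 1)) = 2 * d"
    unfolding set_lebesgue_integral_def ind h_def[symmetric] by (simp add: integral_unique)
qed

lemma compact_lborel_finite:
  fixes E :: "'a::euclidean_space set"
  assumes "compact E"
  shows "E \<in> sets lborel" "emeasure lborel E < \<infinity>"
  using assms emeasure_bounded_finite[OF compact_imp_bounded] by (auto simp: borel_compact)

text \<open>As |z - t| >= |Re z - t|, the estimate reduces to the real line. There -ln s <= ln (1/d)
  + \<psi>(s) for s > 0, and the two one-sided copies of \<open>\<psi>\<close> about Re z contribute
  at most 4d in total. The choice d = m/4 makes this m.\<close>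

lemma log_kernel_integral_le:
  fixes E :: "real set"
  assumes "compact E" "measure lborel E = m" "m > 0" "z \<notin> complex_of_real ` E"
  shows "(LINT t:E|lborel. - ln (cmod (z - of_real t))) \<le> m * (1 + ln (4 / m))"
proof -
  define x where "x = Re z"
  define d where "d = m / 4"
  have d: "d > 0" using assms by (simp add: d_def)
  define \<psi> where "\<psi> s = indicator {0<..d} s *\<^sub>R (2 * (sqrt (d / s) - 1))" for s :: real
  have psi0: "\<psi> s \<ge> 0" for s
    using d by (auto simp: \<psi>_def indicator_def)
  have psi_int: "integrable lborel \<psi>" and psi_le: "integral\<^sup>L lborel \<psi> \<le> 2 * d"
    using sqrt_kernel_integral[OF d] unfolding \<psi>_def set_integrable_def set_lebesgue_integral_def by auto
  have i2: "integrable lborel (\<lambda>t. \<psi> (x + (-1) * t))" and i3: "integrable lborel (\<lambda>t. \<psi> (-x + 1 * t))"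
    using lborel_integrable_real_affine[OF psi_int, of "-1" x] lborel_integrable_real_affine[OF psi_int, of 1 "-x"] by simp_all
  have e2: "integral\<^sup>L lborel (\<lambda>t. \<psi> (x + (-1) * t)) = integral\<^sup>L lborel \<psi>"
    using lborel_integral_real_affine[of "-1" \<psi> x] by simp
  have e3: "integral\<^sup>L lborel (\<lambda>t. \<psi> (-x + 1 * t)) = integral\<^sup>L lborel \<psi>"
    using lborel_integral_real_affine[of 1 \<psi> "-x"] by simp
  have nz: "z - of_real t \<noteq> 0" if "t \<in> E" for t using assms(4) that by auto
  have intL: "integrable lborel (\<lambda>t. indicator E t *\<^sub>R (- ln (cmod (z - of_real t))))"
    by (intro borel_integrable_compact assms) (use assms(4) in \<open>auto intro!: continuous_intros\<close>)
  have E: "E \<in> sets lborel" "emeasure lborel E < \<infinity>"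
    using compact_lborel_finite[OF assms(1)] by auto
  have intc: "integrable lborel (\<lambda>t. indicator E t * ln (1 / d))"
    using E by simp
  have "(LINT t:E|lborel. - ln (cmod (z - of_real t)))
      \<le> (LINT t|lborel. indicator E t * ln (1 / d) + (\<psi> (x + (-1) * t) + \<psi> (-x + 1 * t)))"
    unfolding set_lebesgue_integral_def
  proof (rule integral_mono_AE[OF intL])
    show "integrable lborel (\<lambda>t. indicator E t * ln (1 / d) + (\<psi> (x + (-1) * t) + \<psi> (-x + 1 * t)))"
      using intc i2 i3 by (intro Bochner_Integration.integrable_add) auto
    show "AE t in lborel. indicator E t *\<^sub>R (- ln (cmod (z - of_real t)))
       \<le> indicator E t * ln (1 / d) + (\<psi> (x + (-1) * t) + \<psi> (-x + 1 * t))"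
      \<comment> \<open>At t = Re z the majorant may fail, because \<open>\<psi>\<close> vanishes at
        0.\<close>
      using AE_lborel_singleton[of x]
    proof eventually_elim
      fix t assume tx: "t \<noteq> x"
      define s where "s = \<bar>x - t\<bar>"
      have s: "s > 0" using tx by (simp add: s_def)
      have "s \<le> cmod (z - of_real t)"
        using abs_Re_le_cmod[of "z - of_real t"] by (simp add: s_def x_def)
      then have 1: "- ln (cmod (z - of_real t)) \<le> - ln s"
        using s ln_le_cancel_iff[of s "cmod (z - of_real t)"] by linarith
      have 2: "\<psi> s \<le> \<psi> (x + (-1) * t) + \<psi> (-x + 1 * t)"
        using psi0[of "x - t"] psi0[of "-x + t"] by (auto simp: s_def abs_if)
      have 3: "- ln s \<le> ln (1 / d) + \<psi> s"
      proof (cases "s \<le> d")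
        case True
        have "ln (sqrt (d / s)) \<le> sqrt (d / s) - 1" using d s by (intro ln_le_minus_one) auto
        then have "ln (d / s) \<le> 2 * (sqrt (d / s) - 1)" using d s by (simp add: ln_sqrt)
        then show ?thesis using True s d by (simp add: \<psi>_def ln_div)
      next
        case False
        then show ?thesis using s d psi0[of s] by (simp add: ln_div) (smt (verit) ln_less_cancel_iff)
      qed
      show "indicator E t *\<^sub>R (- ln (cmod (z - of_real t)))
       \<le> indicator E t * ln (1 / d) + (\<psi> (x + (-1) * t) + \<psi> (-x + 1 * t))"
        using 1 2 3 psi0[of s] by (auto simp: indicator_def)
    qed
  qed
  also have "\<dots> = m * ln (1 / d) + (integral\<^sup>L lborel \<psi> + integral\<^sup>L lborel \<psi>)"
    using intc i2 i3 e2 e3 E assms(2) by simp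
  also have "\<dots> \<le> m * (1 + ln (4 / m))"
    using psi_le by (simp add: d_def algebra_simps)
  finally show ?thesis .
qed

text \<open>The integrand is the Green function of the disc |z| < R with pole at the real point t.
  The measure on E is not normalized, so the measure m of E appears as a factor in the bounds
  below.\<close>

definition disc_potential :: "real \<Rightarrow> real set \<Rightarrow> complex \<Rightarrow> real" where
  "disc_potential R E z =
     (LINT t:E|lborel. ln (cmod (of_real (R\<^sup>2) - of_real t * z) / (R * cmod (z - of_real t))))"

context
  fixes R :: real and E :: "real set"
  assumes R: "R > 0" and E: "compact E" "E \<subseteq> {-R<..<R}"
begin

text \<open>The zero R^2/t of the numerator is the reflection of the pole in the circle, which lies
  outside the closed disc.\<close>

lemma disc_kernel_numerator_nonzero:
  assumes "t \<in> E" "cmod z \<le> R"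
  shows "of_real (R\<^sup>2) - of_real t * z \<noteq> 0"
proof
  assume "of_real (R\<^sup>2) - of_real t * z = 0"
  then have "R\<^sup>2 = \<bar>t\<bar> * cmod z"
    by (metis abs_of_nonneg eq_iff_diff_eq_0 norm_mult norm_of_real zero_le_power2)
  moreover have "\<bar>t\<bar> < R" using assms E by force
  then have "\<bar>t\<bar> * cmod z < R * R"
    using assms(2) R by (smt (verit) mult_left_mono mult_strict_right_mono norm_ge_zero)
  ultimately show False by (simp add: power2_eq_square)
qed

lemma disc_kernel_continuous:
  assumes "S \<subseteq> cball 0 R" "S \<inter> complex_of_real ` E = {}"
  shows "continuous_on (E \<times> S)
    (\<lambda>(t, z). ln (cmod (of_real (R\<^sup>2) - of_real t * z) / (R * cmod (z - of_real t))))"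
  unfolding case_prod_unfold
  using R assms disc_kernel_numerator_nonzero
  by (intro continuous_intros) (auto simp: subset_iff)

lemma disc_kernel_continuous1:
  assumes "cmod z \<le> R" "z \<notin> complex_of_real ` E"
  shows "continuous_on E (\<lambda>t. ln (cmod (of_real (R\<^sup>2) - of_real t * z) / (R * cmod (z - of_real t))))"
  using R assms disc_kernel_numerator_nonzero
  by (intro continuous_intros) (auto simp: subset_iff)

text \<open>On the circle R^2 = z * cnj z, so the numerator factors as z * cnj (z - t) and every
  kernel is ln 1.\<close>

lemma disc_potential_boundary:
  assumes "cmod z = R"
  shows "disc_potential R E z = 0"
proof -
  have "cmod (of_real (R\<^sup>2) - of_real t * z) = R * cmod (z - of_real t)" for t
  proof -
    have "of_real (R\<^sup>2) - of_real t * z = z * cnj (z - of_real t)"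
      using assms complex_norm_square[of z] by (simp add: algebra_simps)
    then show ?thesis using assms by (metis complex_mod_cnj norm_mult)
  qed
  then have "ln (cmod (of_real (R\<^sup>2) - of_real t * z) / (R * cmod (z - of_real t))) = 0" for t
    by simp
  then show ?thesis by (simp add: disc_potential_def)
qed

text \<open>In the closed disc the numerator is at most 2 R^2. This leaves ln (2R) - ln |z - t|,
  whose second part is bounded by \<open>log_kernel_integral_le\<close>; 8R is 2R times the 4 from
  there.\<close>

lemma disc_potential_le:
  assumes "cmod z \<le> R" "z \<notin> complex_of_real ` E" "measure lborel E = m" "m > 0"
  shows "disc_potential R E z \<le> m * (1 + ln (8 * R / m))"
proof -
  have ms: "E \<in> sets lborel" "emeasure lborel E < \<infinity>"
    using compact_lborel_finite[OF E(1)] by auto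
  have nz: "z - of_real t \<noteq> 0" if "t \<in> E" for t using assms(2) that by auto
  have i1: "set_integrable lborel E (\<lambda>t. - ln (cmod (z - of_real t)))"
    unfolding set_integrable_def
    by (intro borel_integrable_compact E) (use assms(2) in \<open>auto intro!: continuous_intros\<close>)
  have i2: "set_integrable lborel E (\<lambda>t. ln (2 * R))"
    using ms unfolding set_integrable_def by simp
  have "disc_potential R E z \<le> (LINT t:E|lborel. ln (2 * R) + - ln (cmod (z - of_real t)))"
    unfolding disc_potential_def
  proof (rule set_integral_mono)
    show "set_integrable lborel E (\<lambda>t. ln (cmod (of_real (R\<^sup>2) - of_real t * z) / (R * cmod (z - of_real t))))"
      unfolding set_integrable_def
      by (intro borel_integrable_compact E disc_kernel_continuous1 assms)
    show "set_integrable lborel E (\<lambda>t. ln (2 * R) + - ln (cmod (z - of_real t)))"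
      using i2 i1 by (rule set_integral_add)
    fix t assume t: "t \<in> E"
    have "\<bar>t\<bar> < R" using t E by force
    have "cmod (of_real (R\<^sup>2) - of_real t * z) \<le> R\<^sup>2 + \<bar>t\<bar> * cmod z"
      by (metis abs_of_nonneg norm_mult norm_of_real norm_triangle_ineq4 zero_le_power2)
    also have "\<dots> \<le> R * (2 * R)"
      using \<open>\<bar>t\<bar> < R\<close> assms(1) mult_mono[of "\<bar>t\<bar>" R "cmod z" R] R by (simp add: power2_eq_square)
    finally have "cmod (of_real (R\<^sup>2) - of_real t * z) / (R * cmod (z - of_real t)) \<le> 2 * R / cmod (z - of_real t)"
      using R nz[OF t] by (simp add: divide_simps mult_ac)
    moreover have "0 < cmod (of_real (R\<^sup>2) - of_real t * z) / (R * cmod (z - of_real t))"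
      using R nz[OF t] disc_kernel_numerator_nonzero[OF t assms(1)] by simp
    ultimately have "ln (cmod (of_real (R\<^sup>2) - of_real t * z) / (R * cmod (z - of_real t))) \<le> ln (2 * R / cmod (z - of_real t))"
      by simp
    also have "\<dots> = ln (2 * R) + - ln (cmod (z - of_real t))" using R nz[OF t] by (subst ln_div) auto
    finally show "ln (cmod (of_real (R\<^sup>2) - of_real t * z) / (R * cmod (z - of_real t)))
      \<le> ln (2 * R) + - ln (cmod (z - of_real t))" .
  qed
  also have "\<dots> = m * ln (2 * R) + (LINT t:E|lborel. - ln (cmod (z - of_real t)))"
    using set_integral_add(2)[OF i2 i1] ms assms(3) by (simp add: set_lebesgue_integral_def)
  also have "\<dots> \<le> m * ln (2 * R) + m * (1 + ln (4 / m))"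
    using log_kernel_integral_le[OF E(1) assms(3,4,2)] by simp
  also have "\<dots> = m * (1 + ln (8 * R / m))"
  proof -
    have "ln (2 * R * (4 / m)) = ln (2 * R) + ln (4 / m)"
      using R assms(4) by (intro ln_mult_pos) auto
    then show ?thesis by (simp add: algebra_simps)
  qed
  finally show ?thesis .
qed

lemma disc_potential_ge:
  assumes "cmod z \<le> R" "z \<notin> complex_of_real ` E" "measure lborel E = m" "q > 0"
    "\<And>t. t \<in> E \<Longrightarrow> q * R * cmod (z - of_real t) \<le> cmod (of_real (R\<^sup>2) - of_real t * z)"
  shows "m * ln q \<le> disc_potential R E z"
proof -
  have ms: "E \<in> sets lborel" "emeasure lborel E < \<infinity>"
    using compact_lborel_finite[OF E(1)] by auto
  have "(LINT t:E|lborel. ln q) \<le> disc_potential R E z"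
    unfolding disc_potential_def
  proof (rule set_integral_mono)
    show "set_integrable lborel E (\<lambda>t. ln (cmod (of_real (R\<^sup>2) - of_real t * z) / (R * cmod (z - of_real t))))"
      unfolding set_integrable_def
      by (intro borel_integrable_compact E disc_kernel_continuous1 assms)
    show "set_integrable lborel E (\<lambda>t. ln q)" using ms unfolding set_integrable_def by simp
    fix t assume t: "t \<in> E"
    have nz: "cmod (z - of_real t) > 0" using assms(2) t by auto
    have "q \<le> cmod (of_real (R\<^sup>2) - of_real t * z) / (R * cmod (z - of_real t))"
      using assms(5)[OF t] R nz by (simp add: pos_le_divide_eq mult_ac)
    then show "ln q \<le> ln (cmod (of_real (R\<^sup>2) - of_real t * z) / (R * cmod (z - of_real t)))"
      using assms(4) by simp
  qed
  then show ?thesis using ms assms(3) by (simp add: set_lebesgue_integral_def)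
qed

text \<open>A convergent sequence together with its limit is a compact set off E. The kernel is
  jointly continuous on the product with E, hence bounded, and dominated convergence
  applies.\<close>

lemma disc_potential_continuous:
  "continuous_on (cball 0 R - complex_of_real ` E) (disc_potential R E)"
  unfolding continuous_on_sequentially
proof (intro allI ballI impI, elim conjE)
  fix zs :: "nat \<Rightarrow> complex" and z
  assume z: "z \<in> cball 0 R - complex_of_real ` E"
    and zs: "\<forall>n. zs n \<in> cball 0 R - complex_of_real ` E" and lim: "zs \<longlonglongrightarrow> z"
  define K where "K = insert z (range zs)"
  have K: "compact K" "K \<subseteq> cball 0 R" "K \<inter> complex_of_real ` E = {}"
    using compact_sequence_with_limit[OF lim] z zs by (auto simp: K_def)
  define h where "h t w = ln (cmod (of_real (R\<^sup>2) - of_real t * w) / (R * cmod (w - of_real t)))" for t :: real and w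
  have ch: "continuous_on (E \<times> K) (\<lambda>(t, w). h t w)"
    unfolding h_def using disc_kernel_continuous[OF K(2,3)] .
  then have "bounded ((\<lambda>(t, w). h t w) ` (E \<times> K))"
    using compact_continuous_image compact_imp_bounded compact_Times E(1) K(1) by blast
  then obtain B where B: "\<And>t w. t \<in> E \<Longrightarrow> w \<in> K \<Longrightarrow> \<bar>h t w\<bar> \<le> B"
    unfolding bounded_iff by fastforce
  have hi: "integrable lborel (\<lambda>t. indicator E t *\<^sub>R h t w)" if "w \<in> K" for w
    unfolding h_def using that K by (intro borel_integrable_compact E disc_kernel_continuous1) (auto simp: subset_iff)
  have "(\<lambda>n. LINT t|lborel. indicator E t *\<^sub>R h t (zs n)) \<longlonglongrightarrow> (LINT t|lborel. indicator E t *\<^sub>R h t z)"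
  proof (rule integral_dominated_convergence[where w="\<lambda>t. indicator E t * B"])
    show "(\<lambda>t. indicator E t *\<^sub>R h t z) \<in> borel_measurable lborel"
      using hi[of z] by (auto simp: K_def)
    show "\<And>i. (\<lambda>t. indicator E t *\<^sub>R h t (zs i)) \<in> borel_measurable lborel"
      using hi by (auto simp: K_def)
    show "integrable lborel (\<lambda>t. indicator E t * B)"
      using compact_lborel_finite[OF E(1)] by simp
    show "AE t in lborel. (\<lambda>i. indicator E t *\<^sub>R h t (zs i)) \<longlonglongrightarrow> indicator E t *\<^sub>R h t z"
    proof (rule AE_I2)
      fix t
      show "(\<lambda>i. indicator E t *\<^sub>R h t (zs i)) \<longlonglongrightarrow> indicator E t *\<^sub>R h t z"
      proof (cases "t \<in> E")
        case True
        have "continuous_on K (\<lambda>w. (t, w))" by (intro continuous_intros)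
        then have "continuous_on K (h t)"
          using continuous_on_compose2[OF ch, of K "\<lambda>w. (t, w)"] True by auto
        then have "(\<lambda>i. h t (zs i)) \<longlonglongrightarrow> h t z"
          using lim unfolding continuous_on_sequentially comp_def by (auto simp: K_def)
        then show ?thesis using True by simp
      qed simp
    qed
    show "\<And>i. AE t in lborel. norm (indicator E t *\<^sub>R h t (zs i)) \<le> indicator E t * B"
      using B by (auto simp: indicator_def K_def)
  qed
  then show "(disc_potential R E \<circ> zs) \<longlonglongrightarrow> disc_potential R E z"
    unfolding disc_potential_def set_lebesgue_integral_def comp_def h_def .
qed

text \<open>For fixed t the kernel is, up to a constant, a difference of logarithms of moduli of
  affine functions without zeros in the disc. Each has the mean value property, and Fubini carries
  it over to the integral in t.\<close>

lemma disc_potential_circle_mean: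
  assumes "0 < \<rho>" "cball w \<rho> \<subseteq> cball 0 R" "cball w \<rho> \<inter> complex_of_real ` E = {}"
  shows "set_integrable lborel {0..2*pi} (\<lambda>\<theta>. disc_potential R E (w + of_real \<rho> * cis \<theta>))"
    and "(LINT \<theta>:{0..2*pi}|lborel. disc_potential R E (w + of_real \<rho> * cis \<theta>)) = 2 * pi * disc_potential R E w"
proof -
  define h where "h t w = ln (cmod (of_real (R\<^sup>2) - of_real t * w) / (R * cmod (w - of_real t)))" for t :: real and w
  have inb: "w + of_real \<rho> * cis \<theta> \<in> cball w \<rho>" for \<theta>
    using assms(1) by (simp add: dist_norm norm_mult)
  have cont: "continuous_on (E \<times> {0..2*pi}) (\<lambda>(t, \<theta>). h t (w + of_real \<rho> * cis \<theta>))"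
  proof -
    have "continuous_on (E \<times> {0..2*pi}) (\<lambda>p. (fst p, w + of_real \<rho> * cis (snd p)))"
      by (intro continuous_intros)
    moreover have "(\<lambda>p. (fst p, w + of_real \<rho> * cis (snd p))) ` (E \<times> {0..2*pi}) \<subseteq> E \<times> cball w \<rho>"
      using inb by (auto simp del: mem_cball)
    ultimately show ?thesis
      using continuous_on_compose2[OF disc_kernel_continuous[OF assms(2,3)]]
      by (fastforce simp: h_def case_prod_unfold)
  qed
  have int: "integrable (lborel \<Otimes>\<^sub>M lborel) (\<lambda>(t, \<theta>). indicator E t *\<^sub>R indicator {0..2*pi} \<theta> *\<^sub>R h t (w + of_real \<rho> * cis \<theta>))"
  proof -
    have "integrable lborel (\<lambda>p. indicator (E \<times> {0..2*pi}) p *\<^sub>R (case p of (t, \<theta>) \<Rightarrow> h t (w + of_real \<rho> * cis \<theta>)))"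
      by (intro borel_integrable_compact compact_Times E cont) auto
    then show ?thesis unfolding lborel_prod[symmetric]
      by (rule back_subst[where P="integrable _"]) (auto simp: fun_eq_iff indicator_def)
  qed
  have inner: "(LINT \<theta>:{0..2*pi}|lborel. h t (w + of_real \<rho> * cis \<theta>)) = 2 * pi * h t w" if t: "t \<in> E" for t
  proof -
    have n0: "cmod (of_real (R\<^sup>2) - of_real t * z) > 0" "cmod (z - of_real t) > 0" if "z \<in> cball w \<rho>" for z
      using disc_kernel_numerator_nonzero[OF t, of z] that assms t by auto
    have heq: "h t z = ln (cmod (of_real (R\<^sup>2) + (- of_real t) * z)) - (ln R + ln (cmod (- of_real t + 1 * z)))"
      if "z \<in> cball w \<rho>" for z
      using n0[OF that] R unfolding h_def by (simp add: ln_div ln_mult)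
    have w: "w \<in> cball w \<rho>" using assms(1) by simp
    have c1: "cmod (- of_real t) * \<rho> < cmod (of_real (R\<^sup>2) + (- of_real t) * w)"
    proof -
      have "\<bar>t\<bar> < R" using t E by force
      have "cmod w + \<rho> \<le> R"
      proof -
        \<comment> \<open>The point of the small disc farthest from 0 lies on the ray through w. The
          case w = 0 is separate because \<open>sgn 0 = 0\<close>.\<close>
        have "w + of_real \<rho> * sgn w \<in> cball 0 R \<or> w = 0"
          using assms(1,2) by (intro disjCI subsetD[OF assms(2)]) (auto simp: dist_norm norm_mult norm_sgn)
        moreover have "cmod (w + of_real \<rho> * sgn w) = cmod w + \<rho>" if "w \<noteq> 0"
        proof -
          have "w + of_real \<rho> * sgn w = of_real (cmod w + \<rho>) * sgn w"
            using that by (simp add: sgn_eq field_simps)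
          then have "cmod (w + of_real \<rho> * sgn w) = \<bar>cmod w + \<rho>\<bar> * 1"
            using that by (metis norm_mult norm_of_real norm_sgn)
          then show ?thesis using assms(1) by simp
        qed
        moreover have "\<rho> \<le> R" if "w = 0"
        proof -
          have "of_real \<rho> \<in> cball w \<rho>" using that assms(1) by simp
          then have "complex_of_real \<rho> \<in> cball 0 R" using assms(2) by blast
          then show ?thesis by simp
        qed
        ultimately show ?thesis by (cases "w = 0") auto
      qed
      then have "\<bar>t\<bar> * (cmod w + \<rho>) \<le> \<bar>t\<bar> * R" by (intro mult_left_mono) auto
      also have "\<dots> < R\<^sup>2" using \<open>\<bar>t\<bar> < R\<close> R by (simp add: power2_eq_square)
      finally have "\<bar>t\<bar> * \<rho> < R\<^sup>2 - \<bar>t\<bar> * cmod w" by (simp add: algebra_simps)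
      also have "\<dots> \<le> cmod (of_real (R\<^sup>2) + (- of_real t) * w)"
        using norm_triangle_ineq2[of "complex_of_real (R\<^sup>2)" "of_real t * w"] by (simp add: norm_mult norm_power)
      finally show ?thesis by simp
    qed
    have c2: "cmod 1 * \<rho> < cmod (- of_real t + 1 * w)"
    proof (rule ccontr)
      assume "\<not> ?thesis"
      then have "of_real t \<in> cball w \<rho>" by (simp add: dist_norm)
      then show False using assms(3) t by blast
    qed
    have si: "set_integrable lborel {0..2*pi} (\<lambda>\<theta>. ln (cmod (\<alpha> + \<beta> * (w + of_real \<rho> * cis \<theta>))))"
      if "\<And>z. z \<in> cball w \<rho> \<Longrightarrow> \<alpha> + \<beta> * z \<noteq> 0" for \<alpha> \<beta>
      unfolding set_integrable_def using that inb
      by (intro borel_integrable_compact) (auto intro!: continuous_intros)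
    have s1: "set_integrable lborel {0..2*pi} (\<lambda>\<theta>. ln (cmod (of_real (R\<^sup>2) + (- of_real t) * (w + of_real \<rho> * cis \<theta>))))"
      using n0(1) by (intro si) fastforce
    have s2: "set_integrable lborel {0..2*pi} (\<lambda>\<theta>. ln (cmod (- of_real t + 1 * (w + of_real \<rho> * cis \<theta>))))"
      using n0(2) by (intro si) fastforce
    have s3: "set_integrable lborel {0..2*pi} (\<lambda>\<theta>. ln R)" unfolding set_integrable_def by simp
    have "(LINT \<theta>:{0..2*pi}|lborel. h t (w + of_real \<rho> * cis \<theta>)) =
       (LINT \<theta>:{0..2*pi}|lborel. ln (cmod (of_real (R\<^sup>2) + (- of_real t) * (w + of_real \<rho> * cis \<theta>)))
          - (ln R + ln (cmod (- of_real t + 1 * (w + of_real \<rho> * cis \<theta>)))))"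
      using heq[OF inb] by simp
    also have "\<dots> = 2 * pi * ln (cmod (of_real (R\<^sup>2) + (- of_real t) * w)) - (2 * pi * ln R + 2 * pi * ln (cmod (- of_real t + 1 * w)))"
      using set_integral_diff(2)[OF s1 set_integral_add(1)[OF s3 s2]] set_integral_add(2)[OF s3 s2]
        ln_cmod_affine_circle_mean[OF assms(1) c1] ln_cmod_affine_circle_mean[OF assms(1) c2]
      by (simp add: set_lebesgue_integral_def[of _ _ "\<lambda>\<theta>. ln R"])
    also have "\<dots> = 2 * pi * h t w" unfolding heq[OF w] by (simp add: algebra_simps)
    finally show ?thesis .
  qed
  have fub: "integrable lborel (\<lambda>\<theta>. LINT t|lborel. indicator E t *\<^sub>R indicator {0..2*pi} \<theta> *\<^sub>R h t (w + of_real \<rho> * cis \<theta>))"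
    using lborel_pair.integrable_snd[OF int] by simp
  have pot: "(LINT t|lborel. indicator E t *\<^sub>R indicator {0..2*pi} \<theta> *\<^sub>R h t (w + of_real \<rho> * cis \<theta>))
     = indicator {0..2*pi} \<theta> *\<^sub>R disc_potential R E (w + of_real \<rho> * cis \<theta>)" for \<theta>
    unfolding disc_potential_def set_lebesgue_integral_def h_def[symmetric]
    by (cases "\<theta> \<in> {0..2*pi}") simp_all
  show "set_integrable lborel {0..2*pi} (\<lambda>\<theta>. disc_potential R E (w + of_real \<rho> * cis \<theta>))"
    using fub unfolding pot set_integrable_def .
  have "(LINT \<theta>:{0..2*pi}|lborel. disc_potential R E (w + of_real \<rho> * cis \<theta>))
    = (LINT \<theta>|lborel. LINT t|lborel. indicator E t *\<^sub>R indicator {0..2*pi} \<theta> *\<^sub>R h t (w + of_real \<rho> * cis \<theta>))"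
    unfolding pot set_lebesgue_integral_def ..
  also have "\<dots> = (LINT t|lborel. LINT \<theta>|lborel. indicator E t *\<^sub>R indicator {0..2*pi} \<theta> *\<^sub>R h t (w + of_real \<rho> * cis \<theta>))"
    using lborel_pair.Fubini_integral[OF int] by simp
  also have "\<dots> = (LINT t|lborel. indicator E t *\<^sub>R (2 * pi * h t w))"
    using inner unfolding set_lebesgue_integral_def
    by (intro Bochner_Integration.integral_cong) (auto simp: indicator_def)
  also have "\<dots> = 2 * pi * disc_potential R E w"
    unfolding disc_potential_def set_lebesgue_integral_def h_def[symmetric]
    by (subst integral_mult_right_zero[symmetric]) (simp add: mult.left_commute)
  finally show "(LINT \<theta>:{0..2*pi}|lborel. disc_potential R E (w + of_real \<rho> * cis \<theta>)) = 2 * pi * disc_potential R E w" .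
qed

end

section \<open>A two-constants inequality for subharmonic functions\<close>

lemma open_strict_sublevel_usc:
  assumes "usc_C u"
  shows "open {w. u w < c}"
  unfolding open_dist
proof
  fix z assume "z \<in> {w. u w < c}"
  then obtain d where "d > 0" "\<forall>w. cmod (w - z) < d \<longrightarrow> u w < u z + (c - u z)"
    using assms unfolding usc_C_def by (metis diff_gt_0_iff_gt mem_Collect_eq)
  then show "\<exists>e>0. \<forall>y. dist y z < e \<longrightarrow> y \<in> {w. u w < c}"
    by (auto simp: dist_norm)
qed

text \<open>Maximum principle for u + kG off E, where G is the potential. On the circle G = 0 and u
  <= 0; near E, upper semicontinuity gives u < -P + \<epsilon>, while kG <= P by the choice of k.
  Adding \<eta> |z|^2 makes the sub-mean inequality strict, so that an interior maximum is
  contradictory at once, without any connectedness argument.\<close>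

lemma subharmonic_le_disc_potential:
  assumes u: "subharmonic u" and R: "R > 0" and E: "compact E" "E \<subseteq> {-R<..<R}"
    and m: "measure lborel E = m" "m > 0"
    and u0: "\<And>z. cmod z \<le> R \<Longrightarrow> u z \<le> 0"
    and uE: "\<And>t. t \<in> E \<Longrightarrow> u (of_real t) \<le> - P" and P: "P \<ge> 0"
    and z: "cmod z \<le> R" "z \<notin> complex_of_real ` E"
  shows "u z \<le> - (P / (m * (1 + ln (8 * R / m)))) * disc_potential R E z"
proof -
  define G where "G = disc_potential R E"
  define A where "A = m * (1 + ln (8 * R / m))"
  define k where "k = P / A"
  \<comment> \<open>The bound m <= 2R makes ln (8R/m) nonnegative, hence \<open>A\<close>
    positive.\<close>
  have "m \<le> measure lborel {-R<..<R}"
    using R E compact_lborel_finite[OF E(1)] unfolding m(1)[symmetric]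
    by (intro measure_mono_fmeasurable) (auto simp: fmeasurable_def)
  then have "m \<le> 2 * R" using R by simp
  then have "1 \<le> 8 * R / m" using m by simp
  then have A: "A > 0" unfolding A_def using m by (intro mult_pos_pos add_pos_nonneg) auto
  then have lam: "k \<ge> 0" using P by (simp add: k_def)
  have GA: "k * G w \<le> P" if "cmod w \<le> R" "w \<notin> complex_of_real ` E" for w
  proof -
    have "k * G w \<le> k * A" unfolding G_def A_def
      using disc_potential_le[OF R E that m] lam by (intro mult_left_mono) auto
    then show ?thesis using A by (simp add: k_def)
  qed
  have cE: "compact (complex_of_real ` E)"
    using E by (intro compact_continuous_image) (auto intro!: continuous_intros)
  have main: "u z + k * G z \<le> 2 * \<epsilon>" if \<epsilon>: "\<epsilon> > 0" for \<epsilon>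
  proof -
    define U where "U = {w. u w < - P + \<epsilon>}"
    have usc: "usc_C u" using u by (simp add: subharmonic_def)
    have oU: "open U" unfolding U_def using usc by (rule open_strict_sublevel_usc)
    have EU: "complex_of_real ` E \<subseteq> U" using uE \<epsilon> by (force simp: U_def)
    define K where "K = cball 0 R - U"
    have cK: "compact K" unfolding K_def using oU by (simp add: compact_diff)
    \<comment> \<open>With this choice the perturbation \<eta> |w|^2 is at most \<epsilon> on the
      whole disc.\<close>
    define \<eta> where "\<eta> = \<epsilon> / R\<^sup>2"
    have eta: "\<eta> > 0" using \<epsilon> R by (simp add: \<eta>_def)
    have etaw: "\<eta> * (cmod w)\<^sup>2 \<le> \<epsilon>" if "cmod w \<le> R" for w
    proof -
      have "\<eta> * (cmod w)\<^sup>2 \<le> \<eta> * R\<^sup>2" using that eta by (intro mult_left_mono power_mono) auto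
      then show ?thesis using R by (simp add: \<eta>_def)
    qed
    define v where "v w = u w + k * G w + \<eta> * (cmod w)\<^sup>2" for w
    have vU: "v w \<le> 2 * \<epsilon>" if "w \<in> U" "cmod w \<le> R" "w \<notin> complex_of_real ` E" for w
      using that GA[OF that(2,3)] etaw[OF that(2)] by (simp add: v_def U_def)
    have vK: "v w \<le> 2 * \<epsilon>" if "w \<in> K" for w
    proof -
      have "\<exists>w0\<in>K. \<forall>w\<in>K. v w \<le> v w0"
      proof (rule usc_attains_max[OF cK])
        show "K \<noteq> {}" using that by auto
        fix e :: real and w0 :: complex assume w0: "w0 \<in> K" and e: "e > 0"
        have "continuous_on K (\<lambda>w. k * G w + \<eta> * (cmod w)\<^sup>2)"
          unfolding G_def using EU
          by (intro continuous_intros continuous_on_subset[OF disc_potential_continuous[OF R E]]) (auto simp: K_def)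
        then obtain d1 where d1: "d1 > 0" "\<And>w. w \<in> K \<Longrightarrow> dist w w0 < d1 \<Longrightarrow>
            dist (k * G w + \<eta> * (cmod w)\<^sup>2) (k * G w0 + \<eta> * (cmod w0)\<^sup>2) < e / 2"
          using w0 e unfolding continuous_on_iff by (meson half_gt_zero)
        obtain d2 where d2: "d2 > 0" "\<And>w. cmod (w - w0) < d2 \<Longrightarrow> u w < u w0 + e / 2"
          using usc e unfolding usc_C_def by (meson half_gt_zero)
        show "\<exists>d>0. \<forall>w\<in>K. dist w w0 < d \<longrightarrow> v w < v w0 + e"
        proof (intro exI[of _ "min d1 d2"] conjI ballI impI)
          fix w assume "w \<in> K" "dist w w0 < min d1 d2"
          then have "dist (k * G w + \<eta> * (cmod w)\<^sup>2) (k * G w0 + \<eta> * (cmod w0)\<^sup>2) < e / 2"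
            and "u w < u w0 + e / 2" using d1(2)[of w] d2(2)[of w] by (auto simp: dist_norm)
          then show "v w < v w0 + e" unfolding v_def dist_real_def by linarith
        qed (use d1 d2 in auto)
      qed
      then obtain w0 where w0: "w0 \<in> K" "\<And>w. w \<in> K \<Longrightarrow> v w \<le> v w0" by blast
      have w0R: "cmod w0 \<le> R" and w0E: "w0 \<notin> complex_of_real ` E" using w0 EU by (auto simp: K_def)
      have "v w0 \<le> 2 * \<epsilon>"
      proof (rule ccontr)
        assume big: "\<not> ?thesis"
        have "cmod w0 \<noteq> R"
        proof
          assume "cmod w0 = R"
          then have "v w0 \<le> \<epsilon>" using disc_potential_boundary[OF R E, of w0] u0[of w0] etaw[of w0]
            by (simp add: v_def G_def)
          then show False using big \<epsilon> by simp
        qed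
        then have "w0 \<in> ball 0 R - complex_of_real ` E" using w0R w0E by simp
        moreover have "open (ball 0 R - complex_of_real ` E)"
          using cE by (intro open_Diff compact_imp_closed) auto
        ultimately obtain d where d: "d > 0" "cball w0 d \<subseteq> ball 0 R - complex_of_real ` E"
          by (metis open_contains_cball)
        obtain e where e: "e > 0"
          "\<And>\<rho>. 0 < \<rho> \<Longrightarrow> \<rho> < e \<Longrightarrow> set_integrable lborel {0..2*pi} (\<lambda>\<theta>. u (w0 + of_real \<rho> * cis \<theta>))"
          "\<And>\<rho>. 0 < \<rho> \<Longrightarrow> \<rho> < e \<Longrightarrow> 2 * pi * u w0 \<le> (LINT \<theta>:{0..2*pi}|lborel. u (w0 + of_real \<rho> * cis \<theta>))"
          using subharmonic_sub_mean[OF u, of w0] by metis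
        define \<rho> where "\<rho> = min d (e / 2)"
        have r: "0 < \<rho>" "\<rho> < e" "\<rho> \<le> d" using d e by (auto simp: \<rho>_def)
        have sub: "cball w0 \<rho> \<subseteq> ball 0 R - complex_of_real ` E" using d(2) r(3) by (meson dual_order.trans subset_cball)
        have sub1: "cball w0 \<rho> \<subseteq> cball 0 R" "cball w0 \<rho> \<inter> complex_of_real ` E = {}" 
          using sub by force+
        note Gm = disc_potential_circle_mean[OF R E r(1) sub1, folded G_def]
        note um = e(2,3)[OF r(1,2)]
        note nm = norm_sq_circle_mean[of w0 \<rho>]
        have i1: "set_integrable lborel {0..2*pi} (\<lambda>\<theta>. k * G (w0 + of_real \<rho> * cis \<theta>))"
          and i2: "set_integrable lborel {0..2*pi} (\<lambda>\<theta>. \<eta> * (cmod (w0 + of_real \<rho> * cis \<theta>))\<^sup>2)"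
          using Gm(1) nm(1) by simp_all
        note i3 = set_integral_add(1)[OF um(1) i1]
        \<comment> \<open>The three summands of v obey the sub-mean inequality, the mean value
          property, and the latter with surplus \<eta> \<rho>^2.\<close>
        have "2 * pi * (v w0 + \<eta> * \<rho>\<^sup>2) \<le> (LINT \<theta>:{0..2*pi}|lborel. v (w0 + of_real \<rho> * cis \<theta>))"
          unfolding v_def set_integral_add(2)[OF i3 i2] set_integral_add(2)[OF um(1) i1]
          using um(2) Gm(2) nm(2) by (simp add: algebra_simps)
        also have "\<dots> \<le> (LINT \<theta>:{0..2*pi}|lborel. v w0)"
        proof (rule set_integral_mono)
          show "set_integrable lborel {0..2*pi} (\<lambda>\<theta>. v (w0 + of_real \<rho> * cis \<theta>))"
            unfolding v_def using set_integral_add(1)[OF i3 i2] .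
          show "set_integrable lborel {0..2*pi} (\<lambda>\<theta>. v w0)" unfolding set_integrable_def by simp
          fix \<theta> :: real
          define p where "p = w0 + of_real \<rho> * cis \<theta>"
          have "p \<in> cball w0 \<rho>" using r by (simp add: p_def dist_norm norm_mult)
          then have p: "cmod p \<le> R" "p \<notin> complex_of_real ` E" using sub1 by auto
          show "v p \<le> v w0"
          \<comment> \<open>The circle may leave \<open>K\<close>, on which \<open>w0\<close> is a
            maximum point; in \<open>U\<close> the bound 2 \<epsilon> < v(w0) takes over.\<close>
          proof (cases "p \<in> U")
            case True
            then show ?thesis using vU[OF True p] big by simp
          next
            case False
            then show ?thesis using w0(2)[of p] p by (simp add: K_def)
          qed
        qed
        also have "\<dots> = 2 * pi * v w0" by (simp add: set_lebesgue_integral_def)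
        finally have "2 * pi * (\<eta> * \<rho>\<^sup>2) \<le> 0" by (simp add: distrib_left)
        moreover have "2 * pi * (\<eta> * \<rho>\<^sup>2) > 0" using eta r by simp
        ultimately show False by simp
      qed
      then show ?thesis using w0(2)[OF that] by simp
    qed
    have "v z \<le> 2 * \<epsilon>"
    proof (cases "z \<in> U")
      case True then show ?thesis using vU z by blast
    next
      case False then show ?thesis using vK z by (simp add: K_def)
    qed
    moreover have "0 \<le> \<eta> * (cmod z)\<^sup>2" using eta by simp
    ultimately show ?thesis by (simp add: v_def)
  qed
  have "u z + k * G z \<le> 0"
  proof (rule field_le_epsilon)
    fix e :: real assume "e > 0"
    then show "u z + k * G z \<le> 0 + e" using main[of "e / 2"] by simp
  qed
  then show ?thesis by (simp add: k_def A_def G_def)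
qed

text \<open>The potential lies between m' ln q and m' (1 + ln (8R/m')), where m' is the measure of
  E, so the factor m' cancels. As u(z) <= 0, replacing m' by a lower bound m enlarges the logarithm
  and keeps the inequality.\<close>

lemma subharmonic_two_constants:
  assumes u: "subharmonic u" and R: "R > 0" and E: "compact E" "E \<subseteq> {-R<..<R}"
    and m: "m > 0" "m \<le> measure lborel E"
    and u0: "\<And>z. cmod z \<le> R \<Longrightarrow> u z \<le> 0"
    and uE: "\<And>t. t \<in> E \<Longrightarrow> u (of_real t) \<le> - P" and P: "P \<ge> 0"
    and z: "cmod z \<le> R" "z \<notin> complex_of_real ` E"
    and q: "q \<ge> 1" "\<And>t. t \<in> E \<Longrightarrow> q * R * cmod (z - of_real t) \<le> cmod (of_real (R\<^sup>2) - of_real t * z)"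
  shows "u z * (1 + ln (8 * R / m)) \<le> - P * ln q"
proof -
  define m' where "m' = measure lborel E"
  have m': "m' > 0" using m by (simp add: m'_def)
  have "m' \<le> measure lborel {-R<..<R}"
    using R E compact_lborel_finite[OF E(1)] unfolding m'_def
    by (intro measure_mono_fmeasurable) (auto simp: fmeasurable_def)
  then have "m' \<le> 2 * R" using R by simp
  then have "1 \<le> 8 * R / m'" using m' by simp
  then have L: "1 + ln (8 * R / m') > 0" by (smt (verit) ln_ge_zero)
  have L2: "1 + ln (8 * R / m') \<le> 1 + ln (8 * R / m)"
    using R m m' by (simp add: m'_def frac_le)
  have "u z \<le> - (P / (m' * (1 + ln (8 * R / m')))) * disc_potential R E z"
    using subharmonic_le_disc_potential[OF u R E _ m' u0 uE P z] m'_def by simp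
  also have "\<dots> \<le> - (P / (m' * (1 + ln (8 * R / m')))) * (m' * ln q)"
    using disc_potential_ge[OF R E z, of m' q] q P L m' m'_def
    by (intro mult_left_mono_neg) auto
  also have "\<dots> = - P * ln q / (1 + ln (8 * R / m'))" using m' by simp
  finally have "u z * (1 + ln (8 * R / m')) \<le> - P * ln q"
    using pos_le_divide_eq[OF L] by blast
  moreover have "u z * (1 + ln (8 * R / m)) \<le> u z * (1 + ln (8 * R / m'))"
    using L2 u0[OF z(1)] by (intro mult_left_mono_neg) auto
  ultimately show ?thesis by simp
qed

section \<open>Lebesgue measure of dilated sets\<close>

text \<open>The uncompleted product measure, for which product measurability and Fubini are used;
  the completed measure is treated only in the final theorem.\<close>

abbreviation lborelN :: "nat \<Rightarrow> (nat \<Rightarrow> real) measure" where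
  "lborelN n \<equiv> Pi\<^sub>M {..<n} (\<lambda>_. lborel)"

interpretation lborelN: product_sigma_finite "(\<lambda>_. lborel) :: nat \<Rightarrow> real measure"
  by standard

definition affR :: "nat \<Rightarrow> (nat \<Rightarrow> real) \<Rightarrow> real \<Rightarrow> (nat \<Rightarrow> real) \<Rightarrow> nat \<Rightarrow> real" where
  "affR n w s y = restrict (\<lambda>i. w i + s * y i) {..<n}"

definition zeroR :: "nat \<Rightarrow> nat \<Rightarrow> real" where
  "zeroR n = restrict (\<lambda>_. 0) {..<n}"

lemma space_lborelN: "space (lborelN n) = RV n"
  by (simp add: space_PiM RV_def)

lemma affR_in_RV [simp]: "affR n w s y \<in> RV n"
  by (simp add: affR_def RV_def)

lemma zeroR_in_RV [simp]: "zeroR n \<in> RV n"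
  by (simp add: zeroR_def RV_def)

lemma affR_measurable_pair: "(\<lambda>(s, y). affR n w s y) \<in> measurable (lborel \<Otimes>\<^sub>M lborelN n) (lborelN n)"
  unfolding affR_def case_prod_unfold by measurable

lemma affR_measurable: "affR n w s \<in> measurable (lborelN n) (lborelN n)"
  unfolding affR_def by measurable

lemma emeasure_lborel_affine_vimage:
  assumes "s > 0" "B \<in> sets borel"
  shows "ennreal s * emeasure lborel ((\<lambda>x. t + s * x) -` B) = emeasure lborel B"
proof -
  have "emeasure lborel B = emeasure (density (distr lborel borel (\<lambda>x. t + s * x)) (\<lambda>_. ennreal \<bar>s\<bar>)) B"
    using lborel_real_affine[of s t] assms by simp
  also have "\<dots> = ennreal s * emeasure lborel ((\<lambda>x. t + s * x) -` B)"
    using assms by (simp add: emeasure_density_const emeasure_distr)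
  finally show ?thesis ..
qed

text \<open>By uniqueness of product measures it is enough to look at boxes, where s^n splits into
  one factor s per coordinate.\<close>

lemma emeasure_affR_vimage:
  assumes "s > 0" "A \<in> sets (lborelN n)"
  shows "ennreal (s ^ n) * emeasure (lborelN n) {y \<in> RV n. affR n w s y \<in> A} = emeasure (lborelN n) A"
proof -
  define P where "P = scale_measure (ennreal (s ^ n)) (distr (lborelN n) (lborelN n) (affR n w s))"
  have "P = lborelN n"
  proof (rule lborelN.PiM_eqI)
    show "sets P = sets (lborelN n)" by (simp add: P_def)
    fix B :: "nat \<Rightarrow> real set" assume B: "\<And>i. i \<in> {..<n} \<Longrightarrow> B i \<in> sets lborel"
    then have PB: "Pi\<^sub>E {..<n} B \<in> sets (lborelN n)" by (intro sets_PiM_I_finite) auto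
    have vim: "affR n w s -` Pi\<^sub>E {..<n} B \<inter> space (lborelN n) = Pi\<^sub>E {..<n} (\<lambda>i. (\<lambda>x. w i + s * x) -` B i)"
      unfolding space_PiM affR_def by (auto simp: PiE_iff extensional_def)
    have ms: "(\<lambda>x. w i + s * x) -` B i \<in> sets lborel" if "i \<in> {..<n}" for i
      using measurable_sets[of "\<lambda>x. w i + s * x" borel borel "B i"] B[OF that] by simp
    have PM: "emeasure (lborelN n) (Pi\<^sub>E {..<n} (\<lambda>i. (\<lambda>x. w i + s * x) -` B i))
        = (\<Prod>i<n. emeasure lborel ((\<lambda>x. w i + s * x) -` B i))"
      by (rule lborelN.emeasure_PiM) (use ms in auto)
    have "emeasure P (Pi\<^sub>E {..<n} B) = ennreal (s ^ n) * (\<Prod>i<n. emeasure lborel ((\<lambda>x. w i + s * x) -` B i))"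
      unfolding P_def using PB affR_measurable
      by (simp add: emeasure_distr vim PM)
    also have "\<dots> = (\<Prod>i<n. ennreal s * emeasure lborel ((\<lambda>x. w i + s * x) -` B i))"
      using assms(1) by (simp add: prod.distrib ennreal_power)
    also have "\<dots> = (\<Prod>i<n. emeasure lborel (B i))"
      using B assms(1) by (intro prod.cong refl emeasure_lborel_affine_vimage) auto
    finally show "emeasure P (Pi\<^sub>E {..<n} B) = (\<Prod>i<n. emeasure lborel (B i))" .
  qed simp
  then have "emeasure (lborelN n) A = emeasure P A" by simp
  also have "\<dots> = ennreal (s ^ n) * emeasure (lborelN n) {y \<in> RV n. affR n w s y \<in> A}"
    unfolding P_def using assms affR_measurable
    by (simp add: emeasure_distr space_lborelN vimage_def Int_def conj_commute)
  finally show ?thesis ..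
qed

lemma ballR_sets: "ballR n x \<rho> \<in> sets (lborelN n)"
proof -
  have "ballR n x \<rho> = {y \<in> space (lborelN n). sqrt (\<Sum>i<n. (x i - y i)\<^sup>2) < \<rho>}"
    by (simp add: ballR_def space_lborelN distR_def)
  also have "\<dots> \<in> sets (lborelN n)" by measurable
  finally show ?thesis .
qed

lemma ballR_coord:
  assumes "y \<in> ballR n x \<rho>" "i < n"
  shows "\<bar>x i - y i\<bar> < \<rho>"
proof -
  have "(x i - y i)\<^sup>2 \<le> (\<Sum>i<n. (x i - y i)\<^sup>2)"
    by (rule member_le_sum) (use assms in auto)
  then have "\<bar>x i - y i\<bar> \<le> distR n x y"
    unfolding distR_def by (metis real_sqrt_abs real_sqrt_le_iff)
  then show ?thesis using assms by (simp add: ballR_def)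
qed

lemma ballR_finite: "emeasure (lborelN n) (ballR n x \<rho>) < \<infinity>"
proof -
  have "ballR n x \<rho> \<subseteq> Pi\<^sub>E {..<n} (\<lambda>i. {x i - \<rho>..x i + \<rho>})"
  proof
    fix y assume y: "y \<in> ballR n x \<rho>"
    then have "y i \<in> {x i - \<rho>..x i + \<rho>}" if "i < n" for i
      using ballR_coord[OF y that] by (auto simp: abs_if split: if_splits)
    then show "y \<in> Pi\<^sub>E {..<n} (\<lambda>i. {x i - \<rho>..x i + \<rho>})"
      using y by (auto simp: ballR_def RV_def PiE_iff)
  qed
  then have "emeasure (lborelN n) (ballR n x \<rho>) \<le> emeasure (lborelN n) (Pi\<^sub>E {..<n} (\<lambda>i. {x i - \<rho>..x i + \<rho>}))"
    by (intro emeasure_mono sets_PiM_I_finite) auto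
  also have "\<dots> = (\<Prod>i<n. emeasure lborel {x i - \<rho>..x i + \<rho>})"
    by (rule lborelN.emeasure_PiM) auto
  also have "\<dots> < \<infinity>"
    by (simp add: less_top[symmetric] ennreal_prod_eq_top emeasure_lborel_Icc_eq)
  finally show ?thesis .
qed

lemma distR_affR: 
  assumes "s \<ge> 0"
  shows "distR n w (affR n w s y) = s * distR n (zeroR n) y"
proof -
  have "(\<Sum>i<n. (w i - affR n w s y i)\<^sup>2) = s\<^sup>2 * (\<Sum>i<n. (zeroR n i - y i)\<^sup>2)"
    unfolding affR_def zeroR_def sum_distrib_left
    by (intro sum.cong refl) (auto simp: power_mult_distrib)
  then show ?thesis using assms by (simp add: distR_def real_sqrt_mult)
qed

lemma measure_ballR:
  assumes "\<rho> > 0"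
  shows "measure (lborelN n) (ballR n x \<rho>) = \<rho> ^ n * measure (lborelN n) (ballR n (zeroR n) 1)"
proof -
  have "{y \<in> RV n. affR n x \<rho> y \<in> ballR n x \<rho>} = ballR n (zeroR n) 1"
    using assms by (auto simp: ballR_def distR_affR)
  then have "emeasure (lborelN n) (ballR n x \<rho>) = ennreal (\<rho> ^ n) * emeasure (lborelN n) (ballR n (zeroR n) 1)"
    using emeasure_affR_vimage[OF assms ballR_sets[of n x \<rho>], of x] by simp
  then show ?thesis using assms by (simp add: measure_def enn2real_mult)
qed

text \<open>This replaces integration in polar coordinates: averaging the dilates of A about w
  over the dilation factor s shows that some ray from w meets A in a long set.\<close>

lemma long_radial_slice:
  assumes w: "w \<in> RV n" and \<eta>: "0 < \<eta>" "\<eta> < 1" and \<beta>: "\<beta> > 0"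
    and A: "A \<in> sets (lborelN n)" "A \<subseteq> ballR n w (\<eta> * \<beta>)" "measure (lborelN n) A > 0"
  obtains b E where "b \<in> ballR n (zeroR n) \<beta>" "compact E" "E \<subseteq> {\<eta>..1}"
    "\<And>s. s \<in> E \<Longrightarrow> affR n w s b \<in> A"
    "(1 - \<eta>) * measure (lborelN n) A / (2 * measure (lborelN n) (ballR n (zeroR n) \<beta>)) \<le> measure lborel E"
proof -
  define B where "B = ballR n (zeroR n) \<beta>"
  define V where "V = measure (lborelN n) B"
  define \<alpha> where "\<alpha> = measure (lborelN n) A"
  \<comment> \<open>Half of the average slice length over \<open>B\<close> that the double integral
    guarantees. The strict inequality obtained from halving leaves room for replacing a slice by a
    compact subset.\<close>
  define c where "c = (1 - \<eta>) * \<alpha> / (2 * V)"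
  have Bs: "B \<in> sets (lborelN n)" unfolding B_def by (rule ballR_sets)
  have eB: "emeasure (lborelN n) B = ennreal V"
    unfolding V_def B_def by (rule emeasure_eq_ennreal_measure) (use ballR_finite in \<open>simp add: less_top[symmetric]\<close>)
  have "emeasure (lborelN n) A \<le> emeasure (lborelN n) (ballR n w (\<eta> * \<beta>))"
    using A ballR_sets by (intro emeasure_mono) auto
  then have fA: "emeasure (lborelN n) A \<noteq> \<infinity>" using ballR_finite[of n w "\<eta> * \<beta>"] by (auto simp: top_unique)
  then have eA: "emeasure (lborelN n) A = ennreal \<alpha>"
    unfolding \<alpha>_def by (intro emeasure_eq_ennreal_measure) auto
  have a0: "\<alpha> > 0" using A by (simp add: \<alpha>_def)
  define f where "f s y = indicator {\<eta>..1} s * (indicator A (affR n w s y) :: ennreal)" for s y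
  have f_meas: "case_prod f \<in> borel_measurable (lborel \<Otimes>\<^sub>M lborelN n)"
  proof -
    have "(\<lambda>p. indicator A ((\<lambda>(s, y). affR n w s y) p) :: ennreal) \<in> borel_measurable (lborel \<Otimes>\<^sub>M lborelN n)"
      by (rule measurable_compose[OF affR_measurable_pair]) (use A in simp)
    moreover have "(\<lambda>p. indicator {\<eta>..1} (fst p) :: ennreal) \<in> borel_measurable (lborel \<Otimes>\<^sub>M lborelN n)"
      by measurable
    ultimately show ?thesis unfolding f_def case_prod_unfold by measurable
  qed
  interpret pair_sigma_finite lborel "lborelN n"
    by (intro pair_sigma_finite.intro sigma_finite_lborel lborelN.sigma_finite) simp
  define S where "S y = {s \<in> {\<eta>..1}. affR n w s y \<in> A}" for y
  have S_sets: "S y \<in> sets lborel" if "y \<in> RV n" for y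
  proof -
    have "(\<lambda>s. f s y) \<in> borel_measurable lborel"
      using measurable_Pair1[OF f_meas, of y] that by (simp add: space_lborelN)
    then have "(\<lambda>s. f s y) -` {1} \<inter> space lborel \<in> sets lborel" by (rule measurable_sets) auto
    also have "(\<lambda>s. f s y) -` {1} \<inter> space lborel = S y"
      by (auto simp: f_def S_def split: split_indicator_asm)
    finally show ?thesis .
  qed
  have inner1: "(\<integral>\<^sup>+ s. f s y \<partial>lborel) = emeasure lborel (S y)" if "y \<in> RV n" for y
  proof -
    have "(\<integral>\<^sup>+ s. f s y \<partial>lborel) = (\<integral>\<^sup>+ s. indicator (S y) s \<partial>lborel)"
      by (intro nn_integral_cong) (auto simp: f_def S_def indicator_def)
    then show ?thesis using S_sets[OF that] by simp
  qed
  \<comment> \<open>The dilate of \<open>A\<close> about w by 1/s lies in the ball of radius \<eta>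
    \<beta> / s, which is at most \<beta> for s >= \<eta>. So only y in \<open>B\<close>
    contribute.\<close>
  have S_out: "S y = {}" if "y \<in> RV n" "y \<notin> B" for y
  proof -
    have False if s: "s \<in> {\<eta>..1}" "affR n w s y \<in> A" for s
    proof -
      have "s * distR n (zeroR n) y < \<eta> * \<beta>"
        using A(2) s \<eta> by (auto simp: ballR_def subset_iff distR_affR)
      moreover have "distR n (zeroR n) y \<ge> \<beta>" using \<open>y \<in> RV n\<close> \<open>y \<notin> B\<close> by (simp add: B_def ballR_def)
      then have "\<eta> * \<beta> \<le> s * distR n (zeroR n) y" using s \<eta> \<beta> by (intro mult_mono) auto
      ultimately show False by simp
    qed
    then show ?thesis by (auto simp: S_def)
  qed
  \<comment> \<open>For s <= 1 the dilation by 1/s only increases the measure; the factor s^n is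
    dropped, so no power of \<eta> is lost.\<close>
  have inner2: "ennreal \<alpha> \<le> (\<integral>\<^sup>+ y. indicator A (affR n w s y) \<partial>lborelN n)" if s: "s \<in> {\<eta>..1}" for s
  proof -
    have s0: "s > 0" using s \<eta> by simp
    have "(\<integral>\<^sup>+ y. indicator A (affR n w s y) \<partial>lborelN n) = (\<integral>\<^sup>+ y. indicator {y \<in> RV n. affR n w s y \<in> A} y \<partial>lborelN n)"
      by (intro nn_integral_cong) (auto simp: indicator_def space_lborelN)
    also have "\<dots> = emeasure (lborelN n) {y \<in> RV n. affR n w s y \<in> A}"
      using measurable_sets[OF affR_measurable A(1), of w s]
      by (intro nn_integral_indicator) (simp add: space_lborelN vimage_def Int_def conj_commute)
    finally have eq: "(\<integral>\<^sup>+ y. indicator A (affR n w s y) \<partial>lborelN n) = emeasure (lborelN n) {y \<in> RV n. affR n w s y \<in> A}" .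
    have "ennreal \<alpha> = ennreal (s ^ n) * emeasure (lborelN n) {y \<in> RV n. affR n w s y \<in> A}"
      using emeasure_affR_vimage[OF s0 A(1), of w] eA by simp
    also have "\<dots> \<le> 1 * emeasure (lborelN n) {y \<in> RV n. affR n w s y \<in> A}"
      using s s0 by (intro mult_right_mono) (auto simp: power_le_one)
    finally show ?thesis unfolding eq by simp
  qed
  have "\<exists>y\<in>B. emeasure lborel (S y) > ennreal c"
  proof (rule ccontr)
    assume "\<not> ?thesis"
    then have le: "emeasure lborel (S y) \<le> ennreal c" if "y \<in> B" for y using that by (auto simp: not_less)
    have "ennreal ((1 - \<eta>) * \<alpha>) = (\<integral>\<^sup>+ s. ennreal \<alpha> * indicator {\<eta>..1} s \<partial>lborel)"
      using \<eta> a0 by (simp add: nn_integral_cmult_indicator ennreal_mult mult.commute)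
    also have "\<dots> \<le> (\<integral>\<^sup>+ s. (\<integral>\<^sup>+ y. f s y \<partial>lborelN n) \<partial>lborel)"
    proof (rule nn_integral_mono)
      fix s :: real
      show "ennreal \<alpha> * indicator {\<eta>..1} s \<le> (\<integral>\<^sup>+ y. f s y \<partial>lborelN n)"
        using inner2[of s] by (cases "s \<in> {\<eta>..1}") (auto simp: f_def)
    qed
    also have "\<dots> = (\<integral>\<^sup>+ y. (\<integral>\<^sup>+ s. f s y \<partial>lborel) \<partial>lborelN n)"
      using Fubini'[OF f_meas] by simp
    also have "\<dots> \<le> (\<integral>\<^sup>+ y. ennreal c * indicator B y \<partial>lborelN n)"
    proof (rule nn_integral_mono)
      fix y assume "y \<in> space (lborelN n)"
      then have y: "y \<in> RV n" by (simp add: space_lborelN)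
      show "(\<integral>\<^sup>+ s. f s y \<partial>lborel) \<le> ennreal c * indicator B y"
        using inner1[OF y] le[of y] S_out[OF y] by (cases "y \<in> B") auto
    qed
    also have "\<dots> = ennreal (c * V)"
      using Bs eB a0 \<eta> by (simp add: nn_integral_cmult_indicator ennreal_mult'' V_def)
    finally have "(1 - \<eta>) * \<alpha> \<le> c * V"
      using a0 \<eta> by (subst (asm) ennreal_le_iff) (auto simp: c_def V_def)
    moreover have "c * V \<le> (1 - \<eta>) * \<alpha> / 2" using a0 \<eta> by (cases "V = 0") (auto simp: c_def)
    moreover have "(1 - \<eta>) * \<alpha> > 0" using a0 \<eta> by simp
    ultimately show False by linarith
  qed
  then obtain b where b: "b \<in> B" "emeasure lborel (S b) > ennreal c" by blast
  have bR: "b \<in> RV n" using b(1) by (simp add: B_def ballR_def)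
  have c0: "c \<ge> 0" using a0 \<eta> by (simp add: c_def V_def)
  define \<sigma> where "\<sigma> = measure lborel (S b)"
  have fS: "S b \<in> fmeasurable lborel"
    using S_sets[OF bR] by (rule fmeasurableI2[of "{\<eta>..1}" lborel, rotated 2]) (use \<eta> in \<open>auto simp: S_def fmeasurable_def\<close>)
  then have "emeasure lborel (S b) = ennreal \<sigma>"
    unfolding \<sigma>_def by (simp add: emeasure_eq_measure2)
  then have sc: "\<sigma> > c" using b(2) c0 by (simp add: ennreal_less_iff)
  \<comment> \<open>Inner regularity, with the surplus \<sigma> - c as the permitted loss.\<close>
  obtain E where E: "closed E" "E \<subseteq> S b" "S b - E \<in> lmeasurable" "emeasure lebesgue (S b - E) < ennreal (\<sigma> - c)"
    using sets_lebesgue_inner_closed[of "S b" "\<sigma> - c"] S_sets[OF bR] sc by auto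
  have Es: "E \<in> sets lborel" using E(1) by simp
  have fE: "E \<in> fmeasurable lborel" using fS Es E(2) by (meson fmeasurableI2)
  have "emeasure lborel (S b - E) < ennreal (\<sigma> - c)"
    using E(4) S_sets[OF bR] Es by simp
  then have "measure lborel (S b - E) < \<sigma> - c"
    using emeasure_eq_measure2[OF fmeasurable.Diff[OF fS fE]] sc by (simp add: ennreal_less_iff)
  moreover have "measure lborel (S b - E) = \<sigma> - measure lborel E"
    unfolding \<sigma>_def using fS fE E(2) by (intro measurable_measure_Diff) (auto simp: fmeasurable_def)
  ultimately have "c \<le> measure lborel E" by simp
  moreover have "compact E"
  proof -
    have "bounded {\<eta>..1}" by simp
    moreover have "E \<subseteq> {\<eta>..1}" using E(2) by (auto simp: S_def)
    ultimately show ?thesis using E(1) by (meson bounded_subset compact_eq_bounded_closed)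
  qed
  ultimately show ?thesis
    using E(2) b(1) by (intro that[of b E]) (auto simp: S_def B_def c_def V_def \<alpha>_def)
qed

section \<open>Plurisubharmonic functions on complex lines\<close>

text \<open>The argument need not be extensional, since only coordinates below \<open>n\<close> are
  read. Pointwise differences and multiples can thus be inserted directly, and \<open>L2_set\<close>
  supplies the triangle inequality.\<close>

definition normC :: "nat \<Rightarrow> (nat \<Rightarrow> complex) \<Rightarrow> real" where
  "normC n z = L2_set (\<lambda>i. cmod (z i)) {..<n}"

definition lineC :: "nat \<Rightarrow> (nat \<Rightarrow> complex) \<Rightarrow> (nat \<Rightarrow> complex) \<Rightarrow> complex \<Rightarrow> nat \<Rightarrow> complex" where
  "lineC n a b s = restrict (\<lambda>i. a i + s * b i) {..<n}"

lemma normC_nonneg [simp]: "normC n z \<ge> 0"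
  by (simp add: normC_def)

lemma normC_cong: "(\<And>i. i < n \<Longrightarrow> z i = w i) \<Longrightarrow> normC n z = normC n w"
  unfolding normC_def by (intro L2_set_cong) auto

lemma normC_mono: "(\<And>i. i < n \<Longrightarrow> cmod (z i) \<le> cmod (w i)) \<Longrightarrow> normC n z \<le> normC n w"
  unfolding normC_def by (intro L2_set_mono) auto

lemma normC_add: "normC n (\<lambda>i. z i + w i) \<le> normC n z + normC n w"
proof -
  have "normC n (\<lambda>i. z i + w i) \<le> L2_set (\<lambda>i. cmod (z i) + cmod (w i)) {..<n}"
    unfolding normC_def by (intro L2_set_mono norm_triangle_ineq) auto
  also have "\<dots> \<le> normC n z + normC n w" unfolding normC_def by (rule L2_set_triangle_ineq)
  finally show ?thesis .
qed

lemma normC_mult: "normC n (\<lambda>i. s * z i) = cmod s * normC n z"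
  unfolding normC_def by (simp add: norm_mult L2_set_right_distrib)

lemma normC_diff: "normC n (\<lambda>i. z i - w i) \<le> normC n z + normC n w"
  using normC_add[of n z "\<lambda>i. - w i"] by (simp add: normC_def)

lemma distC_normC: "distC n z w = normC n (\<lambda>i. z i - w i)"
  by (simp add: distC_def normC_def L2_set_def)

lemma distC_zeroC: "distC n (zeroC n) w = normC n w"
  unfolding distC_def normC_def L2_set_def zeroC_def by (intro arg_cong[of _ _ sqrt] sum.cong) auto

lemma distR_normC: "distR n x y = normC n (\<lambda>i. of_real (x i - y i))"
  by (simp add: distR_def normC_def L2_set_def del: of_real_diff)

lemma distC_emb: "distC n (emb n x) (emb n y) = distR n x y"
  unfolding distC_normC distR_normC by (rule normC_cong) (simp add: emb_def)

lemma emb_in_CV [simp]: "emb n x \<in> CV n"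
  by (simp add: emb_def CV_def)

lemma lineC_in_CV [simp]: "lineC n a b s \<in> CV n"
  by (simp add: lineC_def CV_def)

lemma CV_eqI: "z \<in> CV n \<Longrightarrow> w \<in> CV n \<Longrightarrow> (\<And>i. i < n \<Longrightarrow> z i = w i) \<Longrightarrow> z = w"
  unfolding CV_def by (rule PiE_ext) auto

lemma lineC_apply [simp]: "i < n \<Longrightarrow> lineC n a b s i = a i + s * b i"
  by (simp add: lineC_def)

lemma emb_apply [simp]: "i < n \<Longrightarrow> emb n x i = of_real (x i)"
  by (simp add: emb_def)

section \<open>Transfer of upper bounds along complex lines\<close>

lemma psh_line_two_constants:
  assumes f: "psh n f" and R: "R > 0" and E: "compact E" "E \<subseteq> {-R<..<R}"
    and m: "m > 0" "m \<le> measure lborel E"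
    and f0: "\<And>\<zeta>. cmod \<zeta> \<le> R \<Longrightarrow> f (lineC n a b \<zeta>) \<le> 0"
    and fE: "\<And>t. t \<in> E \<Longrightarrow> f (lineC n a b (of_real t)) \<le> - P" and P: "P \<ge> 0"
    and z: "cmod z \<le> R" "z \<notin> complex_of_real ` E"
    and q: "q \<ge> 1" "\<And>t. t \<in> E \<Longrightarrow> q * R * cmod (z - of_real t) \<le> cmod (of_real (R\<^sup>2) - of_real t * z)"
  shows "f (lineC n a b z) * (1 + ln (8 * R / m)) \<le> - P * ln q"
proof -
  define a' b' where "a' = restrict a {..<n}" and "b' = restrict b {..<n}"
  have "a' \<in> CV n" "b' \<in> CV n" by (auto simp: a'_def b'_def CV_def)
  then have "subharmonic (\<lambda>s. f (restrict (\<lambda>i. a' i + s * b' i) {..<n}))"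
    using f unfolding psh_def by blast
  also have "(\<lambda>s. f (restrict (\<lambda>i. a' i + s * b' i) {..<n})) = (\<lambda>s. f (lineC n a b s))"
    unfolding lineC_def a'_def b'_def by (intro ext arg_cong[of _ _ f]) (auto simp: restrict_def)
  finally show ?thesis
    using subharmonic_two_constants[where u="\<lambda>s. f (lineC n a b s)"] R E m f0 fE P z q by blast
qed

text \<open>A point z near the real point x lies on the complexification of the real line through Re z
  in direction Im z, at the parameter value \<i>; its real points are in the real ball.\<close>

lemma psh_real_ball_to_complex_ball:
  assumes f: "psh n f"
    and f0: "\<And>z. z \<in> ballC n (emb n x) t \<Longrightarrow> f z \<le> 0"
    and fP: "\<And>y. y \<in> ballR n x t \<Longrightarrow> f (emb n y) \<le> - P" and P: "P \<ge> 0"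
    and z: "z \<in> ballC n (emb n x) (t / 4)"
  shows "f z * (1 + ln 12) \<le> - P * ln 2"
proof -
  define a b where "a = (\<lambda>i. complex_of_real (Re (z i)))" and "b = (\<lambda>i. complex_of_real (Im (z i)))"
  have zC: "z \<in> CV n" and zd: "normC n (\<lambda>i. emb n x i - z i) < t / 4"
    using z by (auto simp: ballC_def distC_normC)
  have 1: "normC n (\<lambda>i. emb n x i - a i) \<le> normC n (\<lambda>i. emb n x i - z i)"
  proof (rule normC_mono)
    fix i assume "i < n"
    then have "emb n x i - a i = of_real (Re (emb n x i - z i))" by (simp add: a_def)
    then show "cmod (emb n x i - a i) \<le> cmod (emb n x i - z i)"
      by (metis abs_Re_le_cmod norm_of_real)
  qed
  have 2: "normC n b \<le> normC n (\<lambda>i. emb n x i - z i)"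
  proof (rule normC_mono)
    fix i assume "i < n"
    then have "b i = of_real (- Im (emb n x i - z i))" by (simp add: b_def)
    then show "cmod (b i) \<le> cmod (emb n x i - z i)"
      by (metis abs_Im_le_cmod abs_minus_cancel norm_of_real)
  qed
  \<comment> \<open>Both x - Re z and Im z are at most |x - z| < t/4 in norm, so the distance is
    below (1 + |\<zeta>|) t/4; this is where the radius 3 comes from.\<close>
  have dist: "distC n (emb n x) (lineC n a b \<zeta>) < t"
    if "cmod \<zeta> \<le> 3" for \<zeta>
  proof -
    have "distC n (emb n x) (lineC n a b \<zeta>) = normC n (\<lambda>i. (emb n x i - a i) + (- \<zeta>) * b i)"
      unfolding distC_normC by (rule normC_cong) simp
    also have "\<dots> \<le> normC n (\<lambda>i. emb n x i - a i) + cmod \<zeta> * normC n b"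
      using normC_add[of n "\<lambda>i. emb n x i - a i" "\<lambda>i. (- \<zeta>) * b i"] by (simp add: normC_mult[of n "-\<zeta>" b, simplified])
    also have "\<dots> \<le> normC n (\<lambda>i. emb n x i - z i) + cmod \<zeta> * normC n (\<lambda>i. emb n x i - z i)"
      using 1 2 by (intro add_mono mult_left_mono) auto
    also have "\<dots> = normC n (\<lambda>i. emb n x i - z i) * (1 + cmod \<zeta>)"
      by (simp add: algebra_simps)
    also have "\<dots> < t / 4 * (1 + cmod \<zeta>)"
      using zd by (intro mult_strict_right_mono) (auto intro: add_pos_nonneg)
    also have "\<dots> \<le> t / 4 * 4"
      using that order.strict_trans1[OF normC_nonneg zd] by (intro mult_left_mono) auto
    finally show ?thesis by simp
  qed
  have real: "lineC n a b (of_real s) = emb n (restrict (\<lambda>i. Re (z i) + s * Im (z i)) {..<n})" for s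
    by (rule CV_eqI[where n=n]) (auto simp: a_def b_def)
  \<comment> \<open>Here R = 3 and the real interval [-1,1] has length 2.\<close>
  have "f (lineC n a b \<i>) * (1 + ln (8 * 3 / 2)) \<le> - P * ln 2"
  proof (rule psh_line_two_constants[OF f, where E="{-1..1}"])
    show "f (lineC n a b \<zeta>) \<le> 0" if "cmod \<zeta> \<le> 3" for \<zeta>
      using dist[OF that] by (intro f0) (simp add: ballC_def)
    show "f (lineC n a b (of_real s)) \<le> - P" if "s \<in> {-1..1}" for s
    proof -
      have "cmod (of_real s) \<le> 3" using that by (simp add: abs_le_iff)
      from dist[OF this] show ?thesis unfolding real
        by (intro fP) (auto simp: ballR_def RV_def distC_emb)
    qed
    \<comment> \<open>The value q = 2 is admissible because 36 (1 + s^2) <= 81 + s^2 when s^2 <=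
      1.\<close>
    show "2 * 3 * cmod (\<i> - of_real s) \<le> cmod (of_real (3\<^sup>2) - of_real s * \<i>)" if "s \<in> {-1..1}" for s
    proof -
      have "s\<^sup>2 \<le> 1" using that by (simp add: abs_square_le_1 abs_le_iff)
      have "(6 * cmod (\<i> - of_real s))\<^sup>2 \<le> (cmod (9 - of_real s * \<i>))\<^sup>2"
        unfolding power_mult_distrib cmod_power2 using \<open>s\<^sup>2 \<le> 1\<close> by simp
      then have "6 * cmod (\<i> - of_real s) \<le> cmod (9 - of_real s * \<i>)"
        by (rule power2_le_imp_le) simp
      then show ?thesis by simp
    qed
    show "\<i> \<notin> complex_of_real ` {-1..1}" by (auto simp: complex_eq_iff)
  qed (use P in auto)
  moreover have "lineC n a b \<i> = z"
    by (rule CV_eqI[OF _ zC]) (auto simp: a_def b_def complex_eq_iff)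
  ultimately show ?thesis by simp
qed

text \<open>On the line with w at parameter 0 and x at parameter 1, the direction has norm at most 1
  + \<tau>, so the disc of radius R stays in the ball of radius r. The kernel at 0 is R/|s|, which
  is at least R for |s| <= 1. The choice of \<tau> ensures R > 1.\<close>

lemma psh_spread_to_origin:
  fixes r :: real
  defines "\<tau> \<equiv> (r - 1) / 4"
  defines "R \<equiv> (r - \<tau>) / (1 + \<tau>)"
  assumes f: "psh n f" and r: "1 < r" "r \<le> 2" and t: "0 < t" "t \<le> 1"
    and f0: "\<And>z. z \<in> ballC n (zeroC n) r \<Longrightarrow> f z \<le> 0"
    and x: "x \<in> ballC n (zeroC n) 1"
    and fP: "\<And>z. z \<in> ballC n x t \<Longrightarrow> f z \<le> - P" and P: "P \<ge> 0"
    and w: "w \<in> ballC n (zeroC n) \<tau>"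
  shows "f w * (1 + ln (8 * R / (t / (4 * r)))) \<le> - P * ln R"
proof -
  \<comment> \<open>The parameters in [1-m,1] give points within m r < t of x, and m <= 1/4 keeps
    the interval away from 0.\<close>
  define m where "m = t / (4 * r)"
  have tau: "0 < \<tau>" "1 + \<tau> \<le> r" using r by (auto simp: \<tau>_def field_simps)
  have R1: "R > 1" using r tau by (simp add: R_def \<tau>_def field_simps)
  have m: "0 < m" "m \<le> 1 / 4" using t r by (auto simp: m_def field_simps)
  have wC: "w \<in> CV n" "normC n w < \<tau>" and xC: "x \<in> CV n" "normC n x < 1"
    using w x by (auto simp: ballC_def distC_zeroC)
  define b where "b i = x i - w i" for i
  have b: "normC n b \<le> 1 + \<tau>" using normC_diff[of n x w] wC xC unfolding b_def by simp
  have 0: "lineC n w b 0 = w" by (rule CV_eqI) (use wC in auto)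
  have "f (lineC n w b 0) * (1 + ln (8 * R / m)) \<le> - P * ln R"
  proof (rule psh_line_two_constants[OF f, where E="{1-m..1}"])
    show "f (lineC n w b \<zeta>) \<le> 0" if "cmod \<zeta> \<le> R" for \<zeta>
    proof (rule f0)
      have "normC n (lineC n w b \<zeta>) = normC n (\<lambda>i. w i + \<zeta> * b i)" by (rule normC_cong) simp
      also have "\<dots> \<le> normC n w + cmod \<zeta> * normC n b"
        using normC_add[of n w "\<lambda>i. \<zeta> * b i"] by (simp add: normC_mult)
      also have "\<dots> \<le> normC n w + R * (1 + \<tau>)"
        using that b R1 by (intro add_left_mono mult_mono) auto
      also have "\<dots> < r" using wC tau by (simp add: R_def)
      finally show "lineC n w b \<zeta> \<in> ballC n (zeroC n) r" by (simp add: ballC_def distC_zeroC)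
    qed
    show "f (lineC n w b (of_real s)) \<le> - P" if s: "s \<in> {1-m..1}" for s
    proof (rule fP)
      have "distC n x (lineC n w b (of_real s)) = normC n (\<lambda>i. of_real (1 - s) * b i)"
        unfolding distC_normC by (rule normC_cong) (simp add: b_def algebra_simps)
      also have "\<dots> = (1 - s) * normC n b" unfolding normC_mult norm_of_real using s by simp
      also have "\<dots> \<le> m * r" using s b tau m by (intro mult_mono) auto
      also have "\<dots> < t" using t r by (simp add: m_def)
      finally show "lineC n w b (of_real s) \<in> ballC n x t" by (simp add: ballC_def)
    qed
    show "R * R * cmod (0 - of_real s) \<le> cmod (of_real (R\<^sup>2) - of_real s * 0)" if "s \<in> {1-m..1}" for s
      using that m by (simp add: power2_eq_square mult_left_le norm_mult)
  qed (use P R1 m in auto)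
  then show ?thesis unfolding 0 m_def .
qed

text \<open>The line joins 0 to z, with z at parameter 1, and its real segment [-\<tau>,\<tau>] lies
  in the small ball. For these s the kernel |r^2 - s| / (r |1 - s|) at the point 1 is at least the
  quotient inside the logarithm.\<close>

lemma psh_origin_to_unit_ball:
  fixes r :: real
  defines "\<tau> \<equiv> (r - 1) / 4"
  assumes f: "psh n f" and r: "1 < r" "r \<le> 2"
    and f0: "\<And>z. z \<in> ballC n (zeroC n) r \<Longrightarrow> f z \<le> 0"
    and fP: "\<And>z. z \<in> ballC n (zeroC n) \<tau> \<Longrightarrow> f z \<le> - P" and P: "P \<ge> 0"
    and z: "z \<in> ballC n (zeroC n) 1"
  shows "f z * (1 + ln (8 * r / (2 * \<tau>))) \<le> - P * ln ((r\<^sup>2 - \<tau>) / (r * (1 + \<tau>)))"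
proof -
  have tau: "0 < \<tau>" "\<tau> < 1" using r by (auto simp: \<tau>_def)
  have zC: "z \<in> CV n" "normC n z < 1" using z by (auto simp: ballC_def distC_zeroC)
  have 1: "lineC n (\<lambda>_. 0) z 1 = z" by (rule CV_eqI) (use zC in auto)
  have nl: "normC n (lineC n (\<lambda>_. 0) z \<zeta>) = cmod \<zeta> * normC n z" for \<zeta>
    unfolding normC_mult[symmetric] by (rule normC_cong) simp
  have q: "(r\<^sup>2 - \<tau>) / (r * (1 + \<tau>)) \<ge> 1"
  proof -
    have "r\<^sup>2 - \<tau> - r * (1 + \<tau>) = (r - 1) * (3 * r - 1) / 4"
      by (simp add: \<tau>_def power2_eq_square field_simps)
    also have "\<dots> \<ge> 0" using r by simp
    finally show ?thesis using r tau by (simp add: pos_le_divide_eq)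
  qed
  have "f (lineC n (\<lambda>_. 0) z 1) * (1 + ln (8 * r / (2 * \<tau>))) \<le> - P * ln ((r\<^sup>2 - \<tau>) / (r * (1 + \<tau>)))"
  proof (rule psh_line_two_constants[OF f, where E="{-\<tau>..\<tau>}"])
    show "f (lineC n (\<lambda>_. 0) z \<zeta>) \<le> 0" if "cmod \<zeta> \<le> r" for \<zeta>
    proof (rule f0)
      have "cmod \<zeta> * normC n z \<le> r * normC n z" using that by (intro mult_right_mono) auto
      also have "\<dots> < r * 1" using zC r by (intro mult_strict_left_mono) auto
      finally show "lineC n (\<lambda>_. 0) z \<zeta> \<in> ballC n (zeroC n) r" by (simp add: ballC_def distC_zeroC nl)
    qed
    show "f (lineC n (\<lambda>_. 0) z (of_real s)) \<le> - P" if s: "s \<in> {-\<tau>..\<tau>}" for s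
    proof (rule fP)
      have "\<bar>s\<bar> * normC n z \<le> \<tau> * normC n z" using s by (intro mult_right_mono) auto
      also have "\<dots> < \<tau> * 1" using zC tau by (intro mult_strict_left_mono) auto
      finally show "lineC n (\<lambda>_. 0) z (of_real s) \<in> ballC n (zeroC n) \<tau>" by (simp add: ballC_def distC_zeroC nl)
    qed
    show "(r\<^sup>2 - \<tau>) / (r * (1 + \<tau>)) * r * cmod (1 - of_real s) \<le> cmod (of_real (r\<^sup>2) - of_real s * 1)"
      if s: "s \<in> {-\<tau>..\<tau>}" for s
    proof -
      have r2: "r\<^sup>2 \<ge> 1" using r by simp
      have "1 - complex_of_real s = of_real (1 - s)" by simp
      then have "cmod (1 - complex_of_real s) = \<bar>1 - s\<bar>" by (simp only: norm_of_real)
      then have "cmod (1 - complex_of_real s) \<le> 1 + \<tau>" using s tau by simp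
      then have "(r\<^sup>2 - \<tau>) / (r * (1 + \<tau>)) * r * cmod (1 - of_real s) \<le> (r\<^sup>2 - \<tau>) / (r * (1 + \<tau>)) * r * (1 + \<tau>)"
        using r tau r2 by (intro mult_left_mono mult_nonneg_nonneg divide_nonneg_pos) (simp_all add: order.trans[of \<tau> 1])
      also have "\<dots> = (r\<^sup>2 - \<tau>) / (r * (1 + \<tau>)) * (r * (1 + \<tau>))" by (simp only: mult.assoc)
      also have "\<dots> = r\<^sup>2 - \<tau>"
      proof -
        have "r * (1 + \<tau>) \<noteq> 0" using r tau by simp
        then show ?thesis by (metis nonzero_eq_divide_eq)
      qed
      also have "\<dots> \<le> \<bar>r\<^sup>2 - s\<bar>" using s abs_ge_self[of "r\<^sup>2 - s"] by (simp only: atLeastAtMost_iff) linarith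
      also have "\<dots> = cmod (of_real (r\<^sup>2) - of_real s * 1)"
        by (simp only: mult_1_right of_real_diff[symmetric] norm_of_real)
      finally show ?thesis .
    qed
    show "2 * \<tau> \<le> measure lborel {-\<tau>..\<tau>}" using tau by simp
    show "1 \<notin> complex_of_real ` {-\<tau>..\<tau>}" using tau by (auto simp: image_iff complex_eq_iff)
  qed (use P r tau q in auto)
  then show ?thesis unfolding 1 .
qed

text \<open>A bound f <= -P on the real ball passes to -P1 on a complex ball about x, to -P2 on a
  ball about 0, and then to the given point z. There f >= -2, so P cannot be large. Only the middle
  step costs a factor 1 + ln (512/t).\<close>

lemma psh_real_ball_sup_lower_bound:
  fixes r :: real
  assumes r: "1 < r" "r \<le> 2"
  obtains K where "K > 0"
    "\<And>n f x t P z. \<lbrakk>psh n f; \<And>z. z \<in> ballC n (zeroC n) r \<Longrightarrow> f z \<le> 0;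
        z \<in> ballC n (zeroC n) 1; f z \<ge> - 2;
        emb n x \<in> ballC n (zeroC n) 1; 0 < t; t \<le> 1; \<And>z. z \<in> ballC n (emb n x) t \<Longrightarrow> f z \<le> 0;
        P \<ge> 0; \<And>y. y \<in> ballR n x t \<Longrightarrow> f (emb n y) \<le> - P\<rbrakk> \<Longrightarrow> P \<le> K * (1 + ln (512 / t))"
proof
  define \<tau> where "\<tau> = (r - 1) / 4"
  define R where "R = (r - \<tau>) / (1 + \<tau>)"
  define q where "q = (r\<^sup>2 - \<tau>) / (r * (1 + \<tau>))"
  define a where "a = 1 + ln (8 * r / (2 * \<tau>))"
  define K where "K = 2 * a * (1 + ln 12) / (ln q * ln R * ln 2)"
  have tau: "0 < \<tau>" "\<tau> < 1" using r by (auto simp: \<tau>_def)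
  have R: "R > 1" using r by (simp add: R_def \<tau>_def field_simps)
  have "0 \<le> r * \<tau>" using r tau by simp
  then have "R \<le> r" using tau by (simp add: R_def pos_divide_le_eq distrib_left)
  have q: "q > 1"
  proof -
    have "r\<^sup>2 - \<tau> - r * (1 + \<tau>) = (r - 1) * (3 * r - 1) / 4"
      by (simp add: \<tau>_def power2_eq_square field_simps)
    also have "\<dots> > 0" using r by simp
    finally show ?thesis using r tau by (simp add: q_def pos_less_divide_eq)
  qed
  have a: "a > 0"
  proof -
    have "8 * r / (2 * \<tau>) \<ge> 1" using r tau by simp
    then show ?thesis unfolding a_def by (intro add_pos_nonneg ln_ge_zero) auto
  qed
  have l12: "1 + ln 12 > (0::real)" by (intro add_pos_pos) auto
  show "K > 0" unfolding K_def using a q R l12 by (intro divide_pos_pos mult_pos_pos) auto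
  fix n f x t P z
  assume f: "psh n f" and f0: "\<And>z. z \<in> ballC n (zeroC n) r \<Longrightarrow> f z \<le> 0"
    and z: "z \<in> ballC n (zeroC n) 1" "f z \<ge> - 2"
    and x: "emb n x \<in> ballC n (zeroC n) 1" and t: "0 < t" "t \<le> 1"
    and ft: "\<And>z. z \<in> ballC n (emb n x) t \<Longrightarrow> f z \<le> 0"
    and P: "P \<ge> 0" and fP: "\<And>y. y \<in> ballR n x t \<Longrightarrow> f (emb n y) \<le> - P"
  define P1 where "P1 = P * ln 2 / (1 + ln 12)"
  define A where "A = 1 + ln (512 / t)"
  define P2 where "P2 = P1 * ln R / A"
  have A: "A > 0" unfolding A_def using t by (intro add_pos_nonneg ln_ge_zero) auto
  have P1: "P1 \<ge> 0" unfolding P1_def using P l12 by simp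
  have P2: "P2 \<ge> 0" unfolding P2_def using P1 R A by simp
  have f1: "f w \<le> - P1" if "w \<in> ballC n (emb n x) (t / 4)" for w
    using psh_real_ball_to_complex_ball[OF f ft fP P that] l12 pos_le_divide_eq[OF l12, of "f w" "- P * ln 2"]
    by (simp add: P1_def)
  have f2: "f w \<le> - P2" if w: "w \<in> ballC n (zeroC n) \<tau>" for w
  proof -
    have t4: "0 < t / 4" "t / 4 \<le> 1" using t by auto
    have "f w * (1 + ln (8 * R / (t / 4 / (4 * r)))) \<le> - P1 * ln R"
      unfolding R_def \<tau>_def
      using psh_spread_to_origin[OF f r t4 f0 x f1 P1, of w] w by (simp add: \<tau>_def)
    moreover have "f w * A \<le> f w * (1 + ln (8 * R / (t / 4 / (4 * r))))"
    proof (rule mult_left_mono_neg)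
      \<comment> \<open>The argument of the logarithm is 128 R r / t, whence 512.\<close>
      have "R * r \<le> 2 * 2" using \<open>R \<le> r\<close> r R by (intro mult_mono) auto
      then have "8 * R / (t / 4 / (4 * r)) \<le> 512 / t"
        using t r by (simp add: divide_simps)
      moreover have "8 * R / (t / 4 / (4 * r)) > 0" using R t r by simp
      ultimately have "ln (8 * R / (t / 4 / (4 * r))) \<le> ln (512 / t)" by (intro ln_mono)
      then show "1 + ln (8 * R / (t / 4 / (4 * r))) \<le> A" unfolding A_def by simp
      have "ballC n (zeroC n) \<tau> \<subseteq> ballC n (zeroC n) r" using r by (auto simp: ballC_def \<tau>_def field_simps)
      then show "f w \<le> 0" using f0 w by blast
    qed
    ultimately show ?thesis using pos_le_divide_eq[OF A, of "f w" "- P1 * ln R"] by (simp add: P2_def)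
  qed
  have "f z * a \<le> - P2 * ln q"
    using psh_origin_to_unit_ball[OF f r f0 _ P2 z(1)] f2 unfolding a_def q_def \<tau>_def by blast
  moreover have "- 2 * a \<le> f z * a" using z(2) a by (intro mult_right_mono) auto
  ultimately have "P2 * ln q \<le> 2 * a" by simp
  then have "P2 \<le> 2 * a / ln q" using q by (simp add: pos_le_divide_eq)
  then have "P * (ln 2 * ln R / ((1 + ln 12) * A)) \<le> 2 * a / ln q"
    by (simp add: P2_def P1_def)
  moreover have "ln 2 * ln R / ((1 + ln 12) * A) > 0" using R A l12 by (intro divide_pos_pos mult_pos_pos) auto
  ultimately have "P \<le> 2 * a / ln q / (ln 2 * ln R / ((1 + ln 12) * A))"
    by (simp only: pos_le_divide_eq)
  also have "\<dots> = K * A" by (simp add: K_def mult_ac)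
  finally show "P \<le> K * (1 + ln (512 / t))" by (simp add: A_def)
qed

lemma emb_zeroR: "emb n (zeroR n) = zeroC n"
  by (auto simp: emb_def zeroR_def zeroC_def)

text \<open>Along a ray w + s b that meets \<open>A\<close> in a long set E, |b| < \<beta> keeps the
  complex disc of radius R = Q/\<beta> inside the ball of radius Q. The point w is at parameter 0,
  and E lies in [\<eta>,1], where the kernel R/s is at least R.\<close>

lemma psh_radial_two_constants:
  assumes f: "psh n f" and w: "w \<in> RV n" and \<beta>: "0 < \<beta>" "\<beta> < Q" and \<eta>: "0 < \<eta>" "\<eta> < 1"
    and f0: "\<And>z. z \<in> ballC n (emb n w) Q \<Longrightarrow> f z \<le> 0"
    and A: "A \<in> sets (lborelN n)" "A \<subseteq> ballR n w (\<eta> * \<beta>)" "measure (lborelN n) A > 0"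
    and fP: "\<And>y. y \<in> A \<Longrightarrow> f (emb n y) \<le> - P" and P: "P \<ge> 0"
  defines "m \<equiv> (1 - \<eta>) * measure (lborelN n) A / (2 * measure (lborelN n) (ballR n (zeroR n) \<beta>))"
  shows "m > 0" "f (emb n w) * (1 + ln (8 * (Q / \<beta>) / m)) \<le> - P * ln (Q / \<beta>)"
proof -
  \<comment> \<open>The unit ball has positive volume because a dilated translate of it contains
    \<open>A\<close>; this is needed to divide by a ball volume in \<open>m\<close>.\<close>
  have "measure (lborelN n) A \<le> measure (lborelN n) (ballR n w (\<eta> * \<beta>))"
    using A ballR_sets ballR_finite by (intro measure_mono_fmeasurable) (auto simp: fmeasurable_def)
  then have "0 < (\<eta> * \<beta>) ^ n * measure (lborelN n) (ballR n (zeroR n) 1)"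
    using A(3) measure_ballR[of "\<eta> * \<beta>" n w] \<beta> \<eta> by simp
  then have "measure (lborelN n) (ballR n (zeroR n) 1) > 0"
    using \<beta> \<eta> by (simp add: zero_less_mult_iff)
  then have "measure (lborelN n) (ballR n (zeroR n) \<beta>) > 0"
    using measure_ballR[of \<beta> n "zeroR n"] \<beta> by simp
  then show m: "m > 0" using A(3) \<eta> by (simp add: m_def)
  obtain b E where b: "b \<in> ballR n (zeroR n) \<beta>" and E: "compact E" "E \<subseteq> {\<eta>..1}"
    "\<And>s. s \<in> E \<Longrightarrow> affR n w s b \<in> A" "m \<le> measure lborel E"
    using long_radial_slice[OF w \<eta> \<beta>(1) A] unfolding m_def by metis
  define R where "R = Q / \<beta>"
  have R: "R > 1" using \<beta> by (simp add: R_def)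
  have nb: "normC n (emb n b) < \<beta>"
  proof -
    have "normC n (emb n b) = distR n (zeroR n) b"
      using distC_emb[of n "zeroR n" b] by (simp add: emb_zeroR distC_zeroC)
    then show ?thesis using b by (simp add: ballR_def)
  qed
  have 0: "lineC n (emb n w) (emb n b) 0 = emb n w"
    by (rule CV_eqI[where n=n]) auto
  have "f (lineC n (emb n w) (emb n b) 0) * (1 + ln (8 * R / m)) \<le> - P * ln R"
  proof (rule psh_line_two_constants[OF f _ E(1) _ m E(4)])
    show "E \<subseteq> {-R<..<R}" using E(2) R \<eta> by force
    show "f (lineC n (emb n w) (emb n b) \<zeta>) \<le> 0" if "cmod \<zeta> \<le> R" for \<zeta>
    proof (rule f0)
      have "distC n (emb n w) (lineC n (emb n w) (emb n b) \<zeta>) = normC n (\<lambda>i. (- \<zeta>) * emb n b i)"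
        unfolding distC_normC by (rule normC_cong) simp
      also have "\<dots> = cmod \<zeta> * normC n (emb n b)" unfolding normC_mult by simp
      also have "\<dots> \<le> R * normC n (emb n b)" using that by (intro mult_right_mono) auto
      also have "\<dots> < R * \<beta>" using nb R by (intro mult_strict_left_mono) auto
      finally show "lineC n (emb n w) (emb n b) \<zeta> \<in> ballC n (emb n w) Q" using \<beta> by (simp add: ballC_def R_def)
    qed
    show "f (lineC n (emb n w) (emb n b) (of_real s)) \<le> - P" if "s \<in> E" for s
    proof -
      have "lineC n (emb n w) (emb n b) (of_real s) = emb n (affR n w s b)"
        by (rule CV_eqI[where n=n]) (auto simp: affR_def)
      then show ?thesis using fP E(3)[OF that] by simp
    qed
    show "R * R * cmod (0 - of_real s) \<le> cmod (of_real (R\<^sup>2) - of_real s * 0)" if "s \<in> E" for s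
    proof -
      have "\<bar>s\<bar> \<le> 1" using E(2) that \<eta> by force
      then show ?thesis by (simp add: power2_eq_square mult_left_le norm_mult)
    qed
    show "0 \<notin> complex_of_real ` E" using E(2) \<eta> by force
  qed (use R P in auto)
  then show "f (emb n w) * (1 + ln (8 * (Q / \<beta>) / m)) \<le> - P * ln (Q / \<beta>)"
    by (simp add: 0 R_def)
qed

text \<open>The real \<open>Sup\<close> in \<open>F_class\<close> bounds f only if its values are
  bounded above. The ball lies in the product of closed discs and, beyond n, of singletons
  {undefined}; this product is compact by Tychonoff, and finitely many local upper bounds
  suffice.\<close>

lemma usc_CV_bdd_above_ballC:
  assumes "usc_CV n f"
  shows "bdd_above (f ` ballC n (zeroC n) \<rho>)"
proof -
  define K where "K = (Pi\<^sub>E UNIV (\<lambda>i. if i < n then cball 0 \<rho> else {undefined}) :: (nat \<Rightarrow> complex) set)"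
  have "compactin (product_topology (\<lambda>_. euclidean) UNIV) K"
    unfolding K_def by (subst compactin_PiE) auto
  then have cK: "compact K" by (simp add: euclidean_product_topology)
  have K_iff: "z \<in> K \<longleftrightarrow> (\<forall>i. z i \<in> (if i < n then cball 0 \<rho> else {undefined}))" for z
    by (simp add: K_def PiE_iff)
  have CV_iff: "z \<in> CV n \<longleftrightarrow> (\<forall>i. \<not> i < n \<longrightarrow> z i = undefined)" for z
    by (simp add: CV_def PiE_iff extensional_def)
  have KC: "K \<subseteq> CV n"
  proof
    fix z assume "z \<in> K"
    then show "z \<in> CV n" unfolding K_iff CV_iff by (metis singletonD)
  qed
  have sub: "ballC n (zeroC n) \<rho> \<subseteq> K"
  proof
    fix z assume z: "z \<in> ballC n (zeroC n) \<rho>"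
    have "cmod (z i) \<le> \<rho>" if "i < n" for i
    proof -
      have "cmod (z i) \<le> normC n z" unfolding normC_def by (rule member_le_L2_set) (use that in auto)
      then show ?thesis using z by (simp add: ballC_def distC_zeroC)
    qed
    moreover have "z \<in> CV n" using z by (simp add: ballC_def)
    ultimately show "z \<in> K" by (simp add: K_iff CV_iff)
  qed
  have "\<exists>U. open U \<and> z \<in> U \<and> (\<forall>w\<in>U \<inter> K. f w \<le> f z + 1)" if "z \<in> K" for z
  proof -
    have zC: "z \<in> CV n" using KC that by blast
    obtain d where d: "d > 0" "\<And>w. w \<in> CV n \<Longrightarrow> distC n z w < d \<Longrightarrow> f w < f z + 1"
      using assms zC zero_less_one unfolding usc_CV_def by blast
    \<comment> \<open>The distance is at most the sum of n coordinate distances, hence at most n d /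
      (n + 1) < d.\<close>
    define U where "U = (\<Inter>i<n. (\<lambda>w :: nat \<Rightarrow> complex. w i) -` ball (z i) (d / (real n + 1)))"
    have "open U" unfolding U_def
      by (intro open_INT ballI open_vimage open_ball continuous_on_product_coordinates) auto
    moreover have "z \<in> U" using d by (simp add: U_def)
    moreover have "f w \<le> f z + 1" if "w \<in> U \<inter> K" for w
    proof -
      have "distC n z w \<le> (\<Sum>i<n. cmod (z i - w i))"
        unfolding distC_normC normC_def by (rule L2_set_le_sum) auto
      also have "\<dots> \<le> (\<Sum>i<n. d / (real n + 1))"
        using that by (intro sum_mono) (auto simp: U_def dist_norm intro: less_imp_le)
      also have "\<dots> < d" using d by (simp add: field_simps)
      finally show ?thesis using d(2)[of w] that KC by force
    qed
    ultimately show ?thesis by blast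
  qed
  then obtain U where U: "\<And>z. z \<in> K \<Longrightarrow> open (U z)" "\<And>z. z \<in> K \<Longrightarrow> z \<in> U z"
    "\<And>z w. z \<in> K \<Longrightarrow> w \<in> U z \<Longrightarrow> w \<in> K \<Longrightarrow> f w \<le> f z + 1" by (metis IntI)
  obtain D where D: "D \<subseteq> K" "finite D" "K \<subseteq> (\<Union>z\<in>D. U z)"
    using compactE_image[OF cK, of K U] U(1,2) by blast
  have "f w \<le> Max ((\<lambda>z. f z + 1) ` D)" if "w \<in> ballC n (zeroC n) \<rho>" for w
  proof -
    have "w \<in> K" using that sub by blast
    then obtain z where "z \<in> D" "w \<in> U z" using D by blast
    then have "f w \<le> f z + 1" using U(3) D(1) \<open>w \<in> K\<close> by blast
    also have "\<dots> \<le> Max ((\<lambda>z. f z + 1) ` D)" using D(2) \<open>z \<in> D\<close> by (intro Max_ge) auto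
    finally show ?thesis .
  qed
  then show ?thesis by (rule bdd_aboveI2)
qed

lemma zeroC_in_ballC: "\<rho> > 0 \<Longrightarrow> zeroC n \<in> ballC n (zeroC n) \<rho>"
  by (simp add: ballC_def distC_zeroC CV_def) (simp add: normC_def zeroC_def L2_set_def)

text \<open>The supremum over the open unit ball need not be attained; lowering -1 to -2 yields an
  actual point.\<close>

lemma F_class_bounds:
  assumes "f \<in> F_class n r" 
  shows "psh n f" "\<And>z. z \<in> ballC n (zeroC n) r \<Longrightarrow> f z \<le> 0"
    "\<exists>z\<in>ballC n (zeroC n) 1. f z \<ge> - 2"
proof -
  show f: "psh n f" using assms by (simp add: F_class_def)
  then have bdd: "bdd_above (f ` ballC n (zeroC n) \<rho>)" for \<rho>
    by (simp add: psh_def usc_CV_bdd_above_ballC)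
  show "f z \<le> 0" if "z \<in> ballC n (zeroC n) r" for z
    using cSup_upper[OF imageI[OF that] bdd] assms by (simp add: F_class_def)
  have "- 2 < Sup (f ` ballC n (zeroC n) 1)" using assms by (simp add: F_class_def)
  then obtain y where "y \<in> f ` ballC n (zeroC n) 1" "- 2 < y"
    using less_cSup_iff[OF _ bdd] zeroC_in_ballC[of 1 n] by (metis empty_iff imageI zero_less_one)
  then show "\<exists>z\<in>ballC n (zeroC n) 1. f z \<ge> - 2" by force
qed

section \<open>The Remez inequality\<close>

text \<open>Unlike the condition sup f = 0 in \<open>F_class\<close>, these conditions survive a
  decrease of r, which permits r <= 2.\<close>

definition psh_normalized :: "nat \<Rightarrow> real \<Rightarrow> ((nat \<Rightarrow> complex) \<Rightarrow> real) \<Rightarrow> bool" where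
  "psh_normalized n r f \<longleftrightarrow> psh n f \<and> (\<forall>z\<in>ballC n (zeroC n) r. f z \<le> 0)
     \<and> (\<exists>z\<in>ballC n (zeroC n) 1. f z \<ge> - 2)"

text \<open>If no such point existed, \<open>psh_real_ball_sup_lower_bound\<close> would apply with
  P built from K + 1 and bound it by the same expression built from K.\<close>

lemma psh_normalized_large_value:
  fixes r :: real
  assumes r: "1 < r" "r \<le> 2"
  obtains K where "K > 0"
    "\<And>n f x t. \<lbrakk>psh_normalized n r f; emb n x \<in> ballC n (zeroC n) 1; 0 < t; t \<le> 1;
       ballC n (emb n x) t \<subseteq> ballC n (zeroC n) r\<rbrakk>
       \<Longrightarrow> \<exists>y\<in>ballR n x t. f (emb n y) > - K * (1 + ln (512 / t))"
proof -
  obtain K where K: "K > 0" and low: "\<And>n f x t P z. \<lbrakk>psh n f; \<And>z. z \<in> ballC n (zeroC n) r \<Longrightarrow> f z \<le> 0;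
        z \<in> ballC n (zeroC n) 1; f z \<ge> - 2;
        emb n x \<in> ballC n (zeroC n) 1; 0 < t; t \<le> 1; \<And>z. z \<in> ballC n (emb n x) t \<Longrightarrow> f z \<le> 0;
        P \<ge> 0; \<And>y. y \<in> ballR n x t \<Longrightarrow> f (emb n y) \<le> - P\<rbrakk> \<Longrightarrow> P \<le> K * (1 + ln (512 / t))"
    using psh_real_ball_sup_lower_bound[OF r] by metis
  show thesis
  proof (rule that[of "K + 1"])
    show "K + 1 > 0" using K by simp
    fix n f x and t :: real
    assume f: "psh_normalized n r f" and x: "emb n x \<in> ballC n (zeroC n) 1" and t: "0 < t" "t \<le> 1"
      and sub: "ballC n (emb n x) t \<subseteq> ballC n (zeroC n) r"
    obtain z where z: "z \<in> ballC n (zeroC n) 1" "f z \<ge> - 2" using f unfolding psh_normalized_def by blast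
    have pf: "psh n f" and f0: "\<And>w. w \<in> ballC n (zeroC n) r \<Longrightarrow> f w \<le> 0"
      using f by (auto simp: psh_normalized_def)
    have l: "1 + ln (512 / t) > 0" using t by (intro add_pos_nonneg ln_ge_zero) auto
    show "\<exists>y\<in>ballR n x t. f (emb n y) > - (K + 1) * (1 + ln (512 / t))"
    proof (rule ccontr)
      assume "\<not> ?thesis"
      then have le: "f (emb n y) \<le> - ((K + 1) * (1 + ln (512 / t)))" if "y \<in> ballR n x t" for y
        using that by (metis mult_minus_left not_less)
      have "(K + 1) * (1 + ln (512 / t)) \<le> K * (1 + ln (512 / t))"
      proof (rule low[where n=n and f=f, OF pf f0 z x t _ _ le])
        show "f w \<le> 0" if "w \<in> ballC n (emb n x) t" for w using f0 sub that by blast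
        show "0 \<le> (K + 1) * (1 + ln (512 / t))" using K l by simp
      qed
      then show False using l by (simp add: algebra_simps)
    qed
  qed
qed

lemma ballC_ballC_subset:
  assumes "w \<in> ballC n (zeroC n) s" "s + \<rho> \<le> \<sigma>"
  shows "ballC n w \<rho> \<subseteq> ballC n (zeroC n) \<sigma>"
proof
  fix z assume z: "z \<in> ballC n w \<rho>"
  have "normC n z = normC n (\<lambda>i. w i - (w i - z i))" by (rule normC_cong) simp
  also have "\<dots> \<le> normC n w + normC n (\<lambda>i. w i - z i)" by (rule normC_diff)
  also have "normC n w < s" using assms(1) by (simp add: ballC_def distC_zeroC)
  also have "normC n (\<lambda>i. w i - z i) < \<rho>" using z by (simp add: ballC_def distC_normC)
  also note assms(2)
  finally show "z \<in> ballC n (zeroC n) \<sigma>" using z by (simp add: ballC_def distC_zeroC)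
qed

lemma distR_triangle: "distR n y z \<le> distR n x y + distR n x z"
proof -
  have "distR n y z = normC n (\<lambda>i. of_real (x i - z i) - of_real (x i - y i))"
    unfolding distR_normC by (rule normC_cong) simp
  also have "\<dots> \<le> distR n x z + distR n x y" unfolding distR_normC by (rule normC_diff)
  finally show ?thesis by simp
qed

lemma ballR_subset_ballR:
  assumes "y \<in> ballR n x s"
  shows "ballR n x t \<subseteq> ballR n y (s + t)"
proof
  fix z assume "z \<in> ballR n x t"
  then show "z \<in> ballR n y (s + t)"
    using assms distR_triangle[of n y z x] by (auto simp: ballR_def)
qed

lemma emb_in_ballC_iff: "x \<in> RV n \<Longrightarrow> y \<in> RV n \<Longrightarrow> emb n y \<in> ballC n (emb n x) t \<longleftrightarrow> y \<in> ballR n x t"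
  by (simp add: ballC_def ballR_def distC_emb)

lemma one_le_ln_3: "1 \<le> ln (3::real)"
  using exp_le by (simp add: ln_ge_iff)

text \<open>With g = -f(w), the radial inequality reads -L ln R <= g (1 + ln (8/m)) + g ln R, and
  division by ln R leaves g with coefficient 1. The other term stays bounded by C times a logarithm
  because g is of order at most ln (1/t), while R = (r-1)/(4t) makes ln R at least half of ln
  (1/t).\<close>

lemma psh_remez_small_ball:
  fixes r :: real
  assumes r: "1 < r" "r \<le> 2"
  obtains C where "C \<ge> 0"
    "\<And>n f x t A y0 L. \<lbrakk>psh_normalized n r f; x \<in> RV n; 0 < t; t < ((r - 1) / 8)\<^sup>2;
       ballC n (emb n x) t \<subseteq> ballC n (zeroC n) 1; A \<in> sets (lborelN n); A \<subseteq> ballR n x t;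
       measure (lborelN n) A > 0; \<And>y. y \<in> A \<Longrightarrow> f (emb n y) \<le> L; L \<le> 0; y0 \<in> ballR n x t\<rbrakk>
       \<Longrightarrow> f (emb n y0) \<le> C * ln (96 * 4 ^ n * measure (lborelN n) (ballR n x t) / measure (lborelN n) A) + L"
proof -
  obtain K where K: "K > 0" and low: "\<And>n f x t. \<lbrakk>psh_normalized n r f; emb n x \<in> ballC n (zeroC n) 1; 0 < t; t \<le> 1;
       ballC n (emb n x) t \<subseteq> ballC n (zeroC n) r\<rbrakk>
       \<Longrightarrow> \<exists>y\<in>ballR n x t. f (emb n y) > - K * (1 + ln (512 / t))"
    using psh_normalized_large_value[OF r] by metis
  define C where "C = 2 * (K * (2 + ln 512))"
  show thesis
  proof (rule that[of C])
    show C0: "C \<ge> 0" unfolding C_def using K by (intro mult_nonneg_nonneg add_nonneg_nonneg) auto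
    fix n f x A y0 and t L :: real
    assume f: "psh_normalized n r f" and x: "x \<in> RV n" and t: "0 < t" "t < ((r - 1) / 8)\<^sup>2"
      and sub: "ballC n (emb n x) t \<subseteq> ballC n (zeroC n) 1" and A: "A \<in> sets (lborelN n)" "A \<subseteq> ballR n x t"
       "measure (lborelN n) A > 0" and fL: "\<And>y. y \<in> A \<Longrightarrow> f (emb n y) \<le> L" and L: "L \<le> 0"
      and y0: "y0 \<in> ballR n x t"
    define X where "X = measure (lborelN n) (ballR n x t) / measure (lborelN n) A"
    have f0: "f z \<le> 0" if "z \<in> ballC n (zeroC n) r" for z
      using f that by (simp add: psh_normalized_def)
    have t64: "t < (r - 1) / 64"
    proof -
      have "((r - 1) / 8)\<^sup>2 = (r - 1) * (r - 1) / 64" by (simp add: power2_eq_square)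
      also have "\<dots> \<le> (r - 1) * 1 / 64" using r by (intro divide_right_mono mult_left_mono) auto
      finally show ?thesis using t by simp
    qed
    then have t64': "t < 1 / 64" using r by simp
    have b1: "ballC n (zeroC n) 1 \<subseteq> ballC n (zeroC n) r" using r by (auto simp: ballC_def)
    have embB: "emb n y \<in> ballC n (zeroC n) 1" if "y \<in> ballR n x t" for y
      using sub emb_in_ballC_iff[OF x, of y t] that by (auto simp: ballR_def)
    have xB: "x \<in> ballR n x t" using x t by (simp add: ballR_def distR_def)
    obtain y1 where y1: "y1 \<in> ballR n x t" "f (emb n y1) > - K * (1 + ln (512 / t))"
      using low[OF f embB[OF xB] t(1)] sub b1 t64' by auto
    \<comment> \<open>The better of two points: f(w) inherits the lower bound from \<open>y1\<close>
      and still dominates f(y0).\<close>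
    define w where "w = (if f (emb n y0) \<le> f (emb n y1) then y1 else y0)"
    have w: "w \<in> ballR n x t" "f (emb n w) > - K * (1 + ln (512 / t))" "f (emb n y0) \<le> f (emb n w)"
      using y0 y1 by (auto simp: w_def)
    have wR: "w \<in> RV n" using w by (simp add: ballR_def)
    define g where "g = - f (emb n w)"
    have g0: "g \<ge> 0" using f0 embB[OF w(1)] b1 by (auto simp: g_def)
    define R where "R = (r - 1) / (4 * t)"
    \<comment> \<open>The ball of radius 2t about w contains B(x,t). With \<eta> = 1/2 this means
      \<beta> = 4t, the source of 4^n.\<close>
    have A2: "A \<subseteq> ballR n w (1 / 2 * (4 * t))"
      using A(2) ballR_subset_ballR[OF w(1), of t] by auto
    define m where "m = (1 - 1 / 2) * measure (lborelN n) A / (2 * measure (lborelN n) (ballR n (zeroR n) (4 * t)))"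
    have pf: "psh n f" using f by (simp add: psh_normalized_def)
    have fQ: "f z \<le> 0" if "z \<in> ballC n (emb n w) (r - 1)" for z
      using ballC_ballC_subset[OF embB[OF w(1)], of "r - 1" r] f0 that by auto
    have fA: "f (emb n y) \<le> - (- L)" if "y \<in> A" for y using fL[OF that] by simp
    have bQ: "0 < 4 * t" "4 * t < r - 1" using t t64 by auto
    have half: "0 < (1 / 2 :: real)" "(1 / 2 :: real) < 1" by auto
    have L': "0 \<le> - L" using L by simp
    note ps = psh_radial_two_constants[OF pf wR bQ half fQ A(1) A2 A(3) fA L', folded m_def R_def]
    have V: "measure (lborelN n) (ballR n (zeroR n) (4 * t)) = 4 ^ n * measure (lborelN n) (ballR n x t)"
      using measure_ballR[of "4 * t" n "zeroR n"] measure_ballR[of t n x] t by (simp add: power_mult_distrib)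
    have m8: "8 / m = 32 * 4 ^ n * X"
      unfolding m_def V X_def by simp
    have X: "X \<ge> 1"
    proof -
      have "measure (lborelN n) A \<le> measure (lborelN n) (ballR n x t)"
        using A ballR_sets ballR_finite by (intro measure_mono_fmeasurable) (auto simp: fmeasurable_def)
      then show ?thesis using A(3) by (simp add: X_def)
    qed
    have lt: "ln (1 / t) \<ge> 1"
    proof -
      have "3 \<le> 1 / t" using t t64' by (simp add: field_simps)
      then have "ln 3 \<le> ln (1 / t)" by (intro ln_mono) auto
      then show ?thesis using one_le_ln_3 by simp
    qed
    have R0: "R > 0" using r t by (simp add: R_def)
    \<comment> \<open>The assumption on t gives 16 t <= (r-1)^2, which is 1/t <= R^2.\<close>
    have lR: "ln (1 / t) \<le> 2 * ln R"
    proof -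
      have "16 * t \<le> (r - 1)\<^sup>2" using t by (simp add: power_divide)
      then have "1 / t \<le> R\<^sup>2" using t by (simp add: R_def power_divide power_mult_distrib power2_eq_square divide_simps)
      then have "ln (1 / t) \<le> ln (R\<^sup>2)" using t by (intro ln_mono) auto
      then show ?thesis using R0 by (simp add: ln_realpow)
    qed
    have lR0: "ln R > 0" using lR lt by simp
    have "g \<le> K * (1 + ln (512 / t))" using w(2) by (simp add: g_def)
    also have "ln (512 / t) = ln 512 + ln (1 / t)" using t by (simp add: ln_div)
    also have "1 + (ln 512 + ln (1 / t)) \<le> (2 + ln 512) * ln (1 / t)"
    proof -
      have "(1 + ln 512) * 1 \<le> (1 + ln 512) * ln (1 / t)"
        using lt by (intro mult_left_mono add_nonneg_nonneg) auto
      then show ?thesis by (simp add: algebra_simps)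
    qed
    also have "K * ((2 + ln 512) * ln (1 / t)) \<le> K * ((2 + ln 512) * (2 * ln R))"
      using lR K by (intro mult_left_mono add_nonneg_nonneg) auto
    finally have gC: "g \<le> C * ln R" using K by (simp add: C_def mult_ac)
    \<comment> \<open>The summand 1 is at most ln 3, and 96 = 3 * 32.\<close>
    have l8: "1 + ln (8 / m) \<le> ln (96 * 4 ^ n * X)"
    proof -
      have "ln (96 * 4 ^ n * X) = ln (3 * (32 * 4 ^ n * X))" by (simp add: mult.assoc)
      also have "\<dots> = ln 3 + ln (32 * 4 ^ n * X)" using X by (intro ln_mult_pos) auto
      finally show ?thesis using one_le_ln_3 unfolding m8 by simp
    qed
    have l80: "1 + ln (8 / m) \<ge> 0"
    proof -
      have "1 * 1 * 1 \<le> 32 * 4 ^ n * X" using X by (intro mult_mono) auto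
      then show ?thesis unfolding m8 by (intro add_nonneg_nonneg ln_ge_zero) auto
    qed
    have "8 * R / m = R * (8 / m)" by simp
    then have "ln (8 * R / m) = ln R + ln (8 / m)" using ln_mult_pos[OF R0, of "8 / m"] ps(1) by (simp add: mult.commute)
    then have "- L * ln R \<le> g * (1 + ln (8 / m)) + g * ln R" using ps(2) by (simp add: g_def algebra_simps)
    also have "\<dots> \<le> C * ln R * ln (96 * 4 ^ n * X) + g * ln R"
      using gC l8 l80 g0 C0 lR0 by (intro add_right_mono mult_mono) auto
    also have "\<dots> = (C * ln (96 * 4 ^ n * X) + g) * ln R" by (simp add: algebra_simps)
    finally have "- L \<le> C * ln (96 * 4 ^ n * X) + g"
      using lR0 by (rule mult_right_le_imp_le)
    then show "f (emb n y0) \<le> C * ln (96 * 4 ^ n * measure (lborelN n) (ballR n x t) / measure (lborelN n) A) + L"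
      using w(3) by (simp add: g_def X_def)
  qed
qed

text \<open>Here w is taken within \<tau> of the origin, where -f(w) is at most a constant k
  depending on r, and B(x,t) lies in the ball of radius 1 + \<tau> about w. All radii are
  comparable, since t has a positive lower bound.\<close>

lemma psh_remez_large_ball:
  fixes r :: real
  assumes r: "1 < r" "r \<le> 2"
  obtains C where "C \<ge> 0"
    "\<And>n f x t A y0 L. \<lbrakk>n \<ge> 1; psh_normalized n r f; x \<in> RV n; ((r - 1) / 8)\<^sup>2 \<le> t;
       ballC n (emb n x) t \<subseteq> ballC n (zeroC n) 1; A \<in> sets (lborelN n); A \<subseteq> ballR n x t;
       measure (lborelN n) A > 0; \<And>y. y \<in> A \<Longrightarrow> f (emb n y) \<le> L; L \<le> 0; y0 \<in> ballR n x t\<rbrakk>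
       \<Longrightarrow> f (emb n y0) \<le> C * ln (96 * 4 ^ n * measure (lborelN n) (ballR n x t) / measure (lborelN n) A) + L"
proof -
  obtain K where K: "K > 0" and low: "\<And>n f x t. \<lbrakk>psh_normalized n r f; emb n x \<in> ballC n (zeroC n) 1; 0 < t; t \<le> 1;
       ballC n (emb n x) t \<subseteq> ballC n (zeroC n) r\<rbrakk>
       \<Longrightarrow> \<exists>y\<in>ballR n x t. f (emb n y) > - K * (1 + ln (512 / t))"
    using psh_normalized_large_value[OF r] by metis
  define t0 where "t0 = ((r - 1) / 8)\<^sup>2"
  define \<tau> where "\<tau> = (r - 1) / 4"
  define R0 where "R0 = (r - \<tau>) / (1 + \<tau>)"
  \<comment> \<open>For R = R0 the slices in [\<eta>,1] would degenerate, for R = 1 the factor ln R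
    would vanish; the midpoint avoids both. Then \<beta> is fixed by \<eta> \<beta> = 1 + \<tau>,
    which gives (r - \<tau>)/\<beta> = R.\<close>
  define R where "R = (R0 + 1) / 2"
  define \<eta> where "\<eta> = R / R0"
  define \<beta> where "\<beta> = (1 + \<tau>) / \<eta>"
  define G where "G = 16 * R / (1 - \<eta>)"
  define H where "H = \<beta> / t0"
  define M where "M = 1 + ln G + ln H"
  define k where "k = K * (1 + ln (512 / \<tau>))"
  define C where "C = k * M / ln R"
  have tau: "0 < \<tau>" "\<tau> < 1" using r by (auto simp: \<tau>_def)
  have t0: "0 < t0" "t0 \<le> 1" using r unfolding t0_def by (auto simp: power_le_one)
  have "R0 > 1" using r by (simp add: R0_def \<tau>_def field_simps)
  then have R: "R > 1" "R < R0" by (auto simp: R_def)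
  have eta: "0 < \<eta>" "\<eta> < 1" using R by (auto simp: \<eta>_def)
  have etabeta: "\<eta> * \<beta> = 1 + \<tau>" using eta by (simp add: \<beta>_def)
  have beta: "1 \<le> \<beta>" using eta tau by (simp add: \<beta>_def)
  have Qb: "(r - \<tau>) / \<beta> = R"
  proof -
    have "(r - \<tau>) / \<beta> = R0 * \<eta>" by (simp add: \<beta>_def R0_def)
    then show ?thesis using R by (simp add: \<eta>_def)
  qed
  have bQ: "\<beta> < r - \<tau>"
  proof -
    have "r - \<tau> = R * \<beta>" using Qb beta by (simp add: field_simps)
    then show ?thesis using R beta by simp
  qed
  have G: "G \<ge> 1" using R eta by (simp add: G_def)
  have H: "H \<ge> 1" using beta t0 by (simp add: H_def)
  have M: "M \<ge> 1" using G H by (simp add: M_def)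
  have k0: "k \<ge> 0" unfolding k_def using K tau by (intro mult_nonneg_nonneg add_nonneg_nonneg ln_ge_zero) auto
  show thesis
  proof (rule that[of C])
    show C0: "C \<ge> 0" unfolding C_def using k0 M R by simp
    fix n f x A y0 and t L :: real
    assume n: "n \<ge> 1" and f: "psh_normalized n r f" and x: "x \<in> RV n" and t: "((r - 1) / 8)\<^sup>2 \<le> t"
      and sub: "ballC n (emb n x) t \<subseteq> ballC n (zeroC n) 1" and A: "A \<in> sets (lborelN n)" "A \<subseteq> ballR n x t"
       "measure (lborelN n) A > 0" and fL: "\<And>y. y \<in> A \<Longrightarrow> f (emb n y) \<le> L" and L: "L \<le> 0"
      and y0: "y0 \<in> ballR n x t"
    define X where "X = measure (lborelN n) (ballR n x t) / measure (lborelN n) A"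
    have tt0: "t0 \<le> t" "0 < t" using t order.strict_trans2[OF t0(1)] by (auto simp: t0_def)
    have f0: "f z \<le> 0" if "z \<in> ballC n (zeroC n) r" for z
      using f that by (simp add: psh_normalized_def)
    have b1: "ballC n (zeroC n) \<tau> \<subseteq> ballC n (zeroC n) 1" "ballC n (zeroC n) 1 \<subseteq> ballC n (zeroC n) r"
      using r tau by (auto simp: ballC_def)
    have embB: "emb n y \<in> ballC n (zeroC n) 1" if "y \<in> ballR n x t" for y
      using sub emb_in_ballC_iff[OF x, of y t] that by (auto simp: ballR_def)
    obtain w where w: "w \<in> ballR n (zeroR n) \<tau>" "f (emb n w) > - K * (1 + ln (512 / \<tau>))"
      using low[OF f, of "zeroR n" \<tau>] zeroC_in_ballC[of 1 n] tau b1 by (auto simp: emb_zeroR)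
    have wR: "w \<in> RV n" using w by (simp add: ballR_def)
    have wC: "emb n w \<in> ballC n (zeroC n) \<tau>"
      using emb_in_ballC_iff[OF zeroR_in_RV wR] w(1) by (simp add: emb_zeroR)
    have A2: "A \<subseteq> ballR n w (\<eta> * \<beta>)"
    proof -
      have "A \<subseteq> ballR n (zeroR n) 1"
      proof
        fix y assume "y \<in> A"
        then have "y \<in> ballR n x t" using A by blast
        then show "y \<in> ballR n (zeroR n) 1"
          using embB[of y] emb_in_ballC_iff[OF zeroR_in_RV, of y n 1] by (simp add: emb_zeroR ballR_def)
      qed
      also have "\<dots> \<subseteq> ballR n w (\<tau> + 1)" by (rule ballR_subset_ballR[OF w(1)])
      finally show ?thesis by (simp add: etabeta add.commute)
    qed
    define m where "m = (1 - \<eta>) * measure (lborelN n) A / (2 * measure (lborelN n) (ballR n (zeroR n) \<beta>))"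
    have pf: "psh n f" using f by (simp add: psh_normalized_def)
    have fQ: "f z \<le> 0" if "z \<in> ballC n (emb n w) (r - \<tau>)" for z
      using ballC_ballC_subset[OF wC, of "r - \<tau>" r] f0 that by auto
    have fA: "f (emb n y) \<le> - (- L)" if "y \<in> A" for y using fL[OF that] by simp
    have b0: "0 < \<beta>" using beta by simp
    have L': "0 \<le> - L" using L by simp
    note ps = psh_radial_two_constants[OF pf wR b0 bQ eta fQ A(1) A2 A(3) fA L', folded m_def, unfolded Qb]
    have X: "X \<ge> 1"
    proof -
      have "measure (lborelN n) A \<le> measure (lborelN n) (ballR n x t)"
        using A ballR_sets ballR_finite by (intro measure_mono_fmeasurable) (auto simp: fmeasurable_def)
      then show ?thesis using A(3) by (simp add: X_def)
    qed
    \<comment> \<open>The ratio of the radii is \<beta>/t <= \<beta>/t0 = H; it depends on r, so its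
      n-th power cannot be put into d(n).\<close>
    have V: "measure (lborelN n) (ballR n (zeroR n) \<beta>) \<le> H ^ n * measure (lborelN n) (ballR n x t)"
    proof -
      have "\<beta> = H * t0" using t0 by (simp add: H_def)
      then have "measure (lborelN n) (ballR n (zeroR n) \<beta>) = H ^ n * (t0 ^ n * measure (lborelN n) (ballR n (zeroR n) 1))"
        using measure_ballR[of \<beta> n "zeroR n"] beta by (simp add: power_mult_distrib)
      also have "\<dots> \<le> H ^ n * (t ^ n * measure (lborelN n) (ballR n (zeroR n) 1))"
        using H tt0 t0 by (intro mult_left_mono mult_right_mono power_mono) auto
      also have "\<dots> = H ^ n * measure (lborelN n) (ballR n x t)"
        using measure_ballR[of t n x] tt0 by simp
      finally show ?thesis .
    qed
    have m8: "8 * R / m \<le> G * H ^ n * X"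
    proof -
      have "8 * R / m = G * measure (lborelN n) (ballR n (zeroR n) \<beta>) / measure (lborelN n) A"
        by (simp add: m_def G_def)
      also have "\<dots> \<le> G * (H ^ n * measure (lborelN n) (ballR n x t)) / measure (lborelN n) A"
        using V G A(3) by (intro divide_right_mono mult_left_mono) auto
      finally show ?thesis by (simp add: X_def)
    qed
    have Hn: "H ^ n \<ge> 1" using H by simp
    have lX: "ln X \<ge> 0" using X by simp
    have "ln (8 * R / m) \<le> ln (G * H ^ n * X)"
      using m8 R ps(1) by (intro ln_mono) auto
    also have "\<dots> = ln (G * H ^ n) + ln X" using G Hn X by (intro ln_mult_pos mult_pos_pos) auto
    also have "ln (G * H ^ n) = ln G + real n * ln H" using G H Hn by (simp add: ln_mult_pos ln_realpow)
    finally have "1 + ln (8 * R / m) \<le> 1 + ln G + real n * ln H + ln X" by simp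
    \<comment> \<open>The term 1 + ln G is at most n times itself as n >= 1, so the dimension
      appears only as M n.\<close>
    also have "\<dots> \<le> M * (real n + ln X)"
    proof -
      have "(1 + ln G) * 1 \<le> (1 + ln G) * real n" using n G by (intro mult_left_mono) auto
      moreover have "0 \<le> (ln G + ln H) * ln X" using G H lX by (intro mult_nonneg_nonneg add_nonneg_nonneg) auto
      ultimately show ?thesis by (simp add: M_def algebra_simps)
    qed
    \<comment> \<open>Since ln 4 >= 1, the number n is at most ln (4^n): the same d(n) serves for
      every r, and M goes into the constant \<open>C\<close>.\<close>
    also have "\<dots> \<le> M * ln (96 * 4 ^ n * X)"
    proof -
      have "exp 1 \<le> (4::real)" using exp_le by linarith
      then have "1 \<le> ln (4::real)" by (simp add: ln_ge_iff)
      then have "real n * 1 \<le> real n * ln 4" by (intro mult_left_mono) auto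
      also have "\<dots> + ln X = ln (4 ^ n * X)" using X by (simp add: ln_mult_pos ln_realpow)
      also have "\<dots> \<le> ln (96 * 4 ^ n * X)" using X by (intro ln_mono) auto
      finally have "real n + ln X \<le> ln (96 * 4 ^ n * X)" by simp
      then show ?thesis using M by (intro mult_left_mono) auto
    qed
    finally have l8: "1 + ln (8 * R / m) \<le> M * ln (96 * 4 ^ n * X)" .
    have l96: "0 \<le> ln (96 * 4 ^ n * X)"
    proof -
      have "1 * 1 * 1 \<le> 96 * 4 ^ n * X" using X by (intro mult_mono) auto
      then show ?thesis by simp
    qed
    have fw: "0 \<le> - f (emb n w)" "- f (emb n w) \<le> k" using w(2) f0 wC b1 by (auto simp: k_def)
    have "- L * ln R \<le> (- f (emb n w)) * (1 + ln (8 * R / m))" using ps(2) by simp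
    also have "\<dots> \<le> (- f (emb n w)) * (M * ln (96 * 4 ^ n * X))" using l8 fw by (intro mult_left_mono)
    also have "\<dots> \<le> k * (M * ln (96 * 4 ^ n * X))" using fw l96 M by (intro mult_right_mono) auto
    also have "\<dots> = C * ln (96 * 4 ^ n * X) * ln R" using R by (simp add: C_def)
    finally have "- L \<le> C * ln (96 * 4 ^ n * X)"
      by (rule mult_right_le_imp_le) (use R in simp)
    moreover have "f (emb n y0) \<le> 0" using f0 embB[OF y0] b1 by blast
    ultimately show "f (emb n y0) \<le> C * ln (96 * 4 ^ n * measure (lborelN n) (ballR n x t) / measure (lborelN n) A) + L"
      by (simp add: X_def)
  qed
qed

text \<open>Replacing r by min r 2 allows the two ranges of t to be combined. The logarithm is
  nonnegative, so both constants can be raised to their maximum, which is chosen before n.\<close>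

lemma psh_remez:
  fixes r :: real
  assumes "1 < r"
  shows "\<exists>C. \<forall>n\<ge>1. \<forall>f x t A y0 L. f \<in> F_class n r \<longrightarrow> x \<in> RV n \<longrightarrow> 0 < t \<longrightarrow>
       ballC n (emb n x) t \<subseteq> ballC n (zeroC n) 1 \<longrightarrow> A \<in> sets (lborelN n) \<longrightarrow> A \<subseteq> ballR n x t \<longrightarrow>
       measure (lborelN n) A > 0 \<longrightarrow> (\<forall>y\<in>A. f (emb n y) \<le> L) \<longrightarrow> L \<le> 0 \<longrightarrow> y0 \<in> ballR n x t \<longrightarrow>
       f (emb n y0) \<le> C * ln (96 * 4 ^ n * measure (lborelN n) (ballR n x t) / measure (lborelN n) A) + L"
proof -
  define s where "s = min r 2"
  have s: "1 < s" "s \<le> 2" using assms by (auto simp: s_def)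
  obtain C1 where C1: "C1 \<ge> 0" "\<And>n f x t A y0 L. \<lbrakk>psh_normalized n s f; x \<in> RV n; 0 < t; t < ((s - 1) / 8)\<^sup>2;
       ballC n (emb n x) t \<subseteq> ballC n (zeroC n) 1; A \<in> sets (lborelN n); A \<subseteq> ballR n x t;
       measure (lborelN n) A > 0; \<And>y. y \<in> A \<Longrightarrow> f (emb n y) \<le> L; L \<le> 0; y0 \<in> ballR n x t\<rbrakk>
       \<Longrightarrow> f (emb n y0) \<le> C1 * ln (96 * 4 ^ n * measure (lborelN n) (ballR n x t) / measure (lborelN n) A) + L"
    using psh_remez_small_ball[OF s] by metis
  obtain C2 where C2: "C2 \<ge> 0" "\<And>n f x t A y0 L. \<lbrakk>n \<ge> 1; psh_normalized n s f; x \<in> RV n; ((s - 1) / 8)\<^sup>2 \<le> t;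
       ballC n (emb n x) t \<subseteq> ballC n (zeroC n) 1; A \<in> sets (lborelN n); A \<subseteq> ballR n x t;
       measure (lborelN n) A > 0; \<And>y. y \<in> A \<Longrightarrow> f (emb n y) \<le> L; L \<le> 0; y0 \<in> ballR n x t\<rbrakk>
       \<Longrightarrow> f (emb n y0) \<le> C2 * ln (96 * 4 ^ n * measure (lborelN n) (ballR n x t) / measure (lborelN n) A) + L"
    using psh_remez_large_ball[OF s] by metis
  show ?thesis
  proof (intro exI[of _ "max C1 C2"] allI impI)
    fix n f x A y0 and t L :: real
    assume n: "1 \<le> n" and f: "f \<in> F_class n r" and x: "x \<in> RV n" and t: "0 < t"
      and sub: "ballC n (emb n x) t \<subseteq> ballC n (zeroC n) 1" and A: "A \<in> sets (lborelN n)" "A \<subseteq> ballR n x t"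
       "measure (lborelN n) A > 0" and fL: "\<forall>y\<in>A. f (emb n y) \<le> L" and L: "L \<le> 0"
      and y0: "y0 \<in> ballR n x t"
    define Y where "Y = 96 * 4 ^ n * measure (lborelN n) (ballR n x t) / measure (lborelN n) A"
    have "ballC n (zeroC n) s \<subseteq> ballC n (zeroC n) r" by (auto simp: ballC_def s_def)
    then have nf: "psh_normalized n s f"
      using F_class_bounds[OF f] by (auto simp: psh_normalized_def)
    have "measure (lborelN n) A \<le> measure (lborelN n) (ballR n x t)"
      using A ballR_sets ballR_finite by (intro measure_mono_fmeasurable) (auto simp: fmeasurable_def)
    then have "1 * measure (lborelN n) A \<le> 96 * 4 ^ n * measure (lborelN n) (ballR n x t)"
      using mult_mono[of 1 96 1 "4 ^ n :: real"] by (intro mult_mono) auto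
    then have "Y \<ge> 1" using A(3) by (simp add: Y_def)
    then have lY: "ln Y \<ge> 0" by simp
    have "f (emb n y0) \<le> C1 * ln Y + L \<or> f (emb n y0) \<le> C2 * ln Y + L"
      using C1(2)[OF nf x t _ sub A _ L y0] C2(2)[OF n nf x _ sub A _ L y0] fL
      unfolding Y_def by (meson not_le)
    moreover have "C1 * ln Y \<le> max C1 C2 * ln Y" "C2 * ln Y \<le> max C1 C2 * ln Y"
      using lY by (auto intro: mult_right_mono)
    ultimately show "f (emb n y0) \<le> max C1 C2 * ln (96 * 4 ^ n * measure (lborelN n) (ballR n x t) / measure (lborelN n) A) + L"
      unfolding Y_def by linarith
  qed
qed

theorem theorem1p2:
  shows "\<exists>(C :: real \<Rightarrow> real \<Rightarrow> real) (D :: nat \<Rightarrow> real).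
    \<forall>n r a f x t \<omega>.
      n \<ge> 1 \<longrightarrow> r > 1 \<longrightarrow> a > 1 \<longrightarrow> f \<in> F_class n r \<longrightarrow>
      x \<in> RV n \<longrightarrow> t > 0 \<longrightarrow>
      emb n ` ballR n x t \<subseteq> ballC n (emb n x) (a * t) \<longrightarrow>
      ballC n (emb n x) (a * t) \<subseteq> ballC n (zeroC n) 1 \<longrightarrow>
      \<omega> \<subseteq> ballR n x t \<longrightarrow> \<omega> \<in> sets (lebN n) \<longrightarrow> measure (lebN n) \<omega> > 0 \<longrightarrow>
      Sup ((\<lambda>y. f (emb n y)) ` ballR n x t)
        \<le> C a r * ln (D n * measure (lebN n) (ballR n x t) / measure (lebN n) \<omega>)
           + Sup ((\<lambda>y. f (emb n y)) ` \<omega>)"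
proof -
  obtain c where c: "\<And>r n f x t A y0 L. 1 < r \<Longrightarrow> 1 \<le> n \<Longrightarrow> f \<in> F_class n r \<Longrightarrow> x \<in> RV n \<Longrightarrow> 0 < t \<Longrightarrow>
       ballC n (emb n x) t \<subseteq> ballC n (zeroC n) 1 \<Longrightarrow> A \<in> sets (lborelN n) \<Longrightarrow> A \<subseteq> ballR n x t \<Longrightarrow>
       measure (lborelN n) A > 0 \<Longrightarrow> (\<forall>y\<in>A. f (emb n y) \<le> L) \<Longrightarrow> L \<le> 0 \<Longrightarrow> y0 \<in> ballR n x t \<Longrightarrow>
       f (emb n y0) \<le> c r * ln (96 * 4 ^ n * measure (lborelN n) (ballR n x t) / measure (lborelN n) A) + L"
    using psh_remez by metis
  show ?thesis
  proof (intro exI[of _ "\<lambda>a. c"] exI[of _ "\<lambda>n. 96 * 4 ^ n"] allI impI)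
    fix n and r a t :: real and f x \<omega>
    assume n: "n \<ge> 1" and r: "r > 1" and a: "a > 1" and f: "f \<in> F_class n r" and x: "x \<in> RV n" and t: "t > 0"
      and sub: "ballC n (emb n x) (a * t) \<subseteq> ballC n (zeroC n) 1"
      and \<omega>: "\<omega> \<subseteq> ballR n x t" "\<omega> \<in> sets (lebN n)" "measure (lebN n) \<omega> > 0"
    have "t \<le> a * t" using a t by simp
    then have sub1: "ballC n (emb n x) t \<subseteq> ballC n (zeroC n) 1"
      using sub by (auto simp: ballC_def subset_iff)
    \<comment> \<open>A subset of \<omega> of the same measure that is measurable for the
      uncompleted product; the supremum over \<omega> still bounds f on it.\<close>
    define A where "A = main_part (lborelN n) \<omega>"
    have \<omega>': "\<omega> \<in> sets (completion (lborelN n))" using \<omega>(2) by (simp add: lebN_def)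
    have A: "A \<in> sets (lborelN n)" "A \<subseteq> \<omega>"
      using main_part_sets[OF \<omega>'] main_part_null_part_Un[OF \<omega>'] by (auto simp: A_def)
    have mA: "measure (lebN n) \<omega> = measure (lborelN n) A"
      using emeasure_completion[OF \<omega>'] by (simp add: lebN_def measure_def A_def)
    have mB: "measure (lebN n) (ballR n x t) = measure (lborelN n) (ballR n x t)"
      using ballR_sets by (simp add: lebN_def measure_completion)
    have "ballC n (zeroC n) 1 \<subseteq> ballC n (zeroC n) r" using r by (auto simp: ballC_def)
    then have le0: "f (emb n y) \<le> 0" if "y \<in> ballR n x t" for y
      using F_class_bounds(2)[OF f] emb_in_ballC_iff[OF x, of y t] that sub1 by (force simp: ballR_def)
    have "\<omega> \<noteq> {}" using \<omega>(3) by auto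
    define L where "L = Sup ((\<lambda>y. f (emb n y)) ` \<omega>)"
    \<comment> \<open>A real \<open>Sup\<close> is an upper bound only for bounded sets; f <= 0 on
      the real ball provides this, as well as \<open>L \<le> 0\<close>.\<close>
    have bdd: "bdd_above ((\<lambda>y. f (emb n y)) ` \<omega>)"
      by (rule bdd_aboveI2[of _ _ 0]) (use le0 \<omega>(1) in auto)
    have L0: "L \<le> 0" unfolding L_def
      using \<open>\<omega> \<noteq> {}\<close> le0 \<omega>(1) by (intro cSup_least) auto
    have fL: "\<forall>y\<in>A. f (emb n y) \<le> L"
      unfolding L_def using A(2) by (auto intro!: cSup_upper[OF _ bdd])
    have xB: "x \<in> ballR n x t" using x t by (simp add: ballR_def distR_def)
    show "Sup ((\<lambda>y. f (emb n y)) ` ballR n x t)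
        \<le> c r * ln (96 * 4 ^ n * measure (lebN n) (ballR n x t) / measure (lebN n) \<omega>)
           + Sup ((\<lambda>y. f (emb n y)) ` \<omega>)"
    proof (rule cSup_least)
      fix v assume "v \<in> (\<lambda>y. f (emb n y)) ` ballR n x t"
      then obtain y where y: "y \<in> ballR n x t" "v = f (emb n y)" by blast
      show "v \<le> c r * ln (96 * 4 ^ n * measure (lebN n) (ballR n x t) / measure (lebN n) \<omega>)
           + Sup ((\<lambda>y. f (emb n y)) ` \<omega>)"
        using c[OF r n f x t sub1 A(1) _ _ fL L0 y(1)] A(2) \<omega>(1,3) y(2)
        unfolding mA mB L_def by auto
    qed (use xB in auto)
  qed
qed

end
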